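(* Let $m\geq 2$. (1) There is no primitive necklace system $S$ modulo $m$ with $|S|=2$. (2) If $S=\{a,b\}$ is a primitive signed necklace system modulo $m$, then $ab\equiv 1+m\bmod 2m$, $a\equiv b+m\bmod 2m$, and $a,b\not\equiv 1\bmod 2m$. Moreover, $\{m-1,\,2m-1\}$ is a primitive signed necklace system modulo $m$. (3) If $S=\{a,b,c\}$ is a multiset of residue classes modulo $m$ with $a^2\equiv b^2\equiv c^2\equiv 1\bmod m$, $abc\equiv 1\bmod m$, and $a,b,c\not\equiv 1\bmod m$, then $S$ is a primitive necklace system modulo $m$.
   Context: A residue class (modulo some integer) is empty if it contains no primes and isolated if it contains exactly one prime. For a finite multiset $S$, "subsets" $T\subseteq S$ are sub-multisets (elements counted with multiplicity as indexed elements), and $\prod T$ is the product of the elements of $T$ (empty product $=1$). A necklace system modulo $m$ is a finite multiset $S$ of residue classes modulo $m$ such that (i) $S$ contains no empty class and each isolated class appears at most once, and (ii) for every $a\in\mathbb{Z}/(m)$, the number of $T\subseteq S$ with $\prod T\equiv a \bmod m$ and $|T|$ even equals the number of such $T$ with $|T|$ odd. For a class $a$ modulo $2m$ write $a\equiv r+cm\bmod 2m$ with $0\le r<m$ and $c\in\{0,1\}$, and set $\mathrm{sgn}(a)=c$. A signed necklace system modulo $m$ is a finite multiset $S$ of residue classes modulo $2m$ such that (i) $S$ contains no empty class and each isolated class appears at most once, and (ii) for every $a\in\mathbb{Z}/(m)$, the number of $T\subseteq S$ with $\prod T\equiv a\bmod m$ and $|T|+\mathrm{sgn}(\prod T)$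 even (with $\prod T$ taken modulo $2m$) equals the number of such $T$ with $|T|+\mathrm{sgn}(\prod T)$ odd. A (signed) necklace system is primitive if no proper sub-multiset of it is a (signed) necklace system.
   Formalization: The "Moreover" of (2) is proved for m = 3 and even m ≥ 4 only: for m = 2 the subset {1} is already a signed necklace system, and for odd m ≥ 5 the class m−1 mod 2m is empty. Condition (ii) is still shown for all m ≥ 2, and that no proper sub-multiset satisfies it for m ≥ 3. *)

theory Defs
  imports "HOL-Library.Multiset" "HOL-Number_Theory.Number_Theory"
begin

text \<open>A residue class modulo \<open>n\<close> is represented by its least nonnegative representative,
  an integer in \<open>{0..<n}\<close>.\<close>

definition class_primes :: "int \<Rightarrow> int \<Rightarrow> int set" where
  "class_primes n r = {p. prime p \<and> [p = r] (mod n)}"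

definition empty_class :: "int \<Rightarrow> int \<Rightarrow> bool" where
  "empty_class n r \<longleftrightarrow> class_primes n r = {}"

definition isolated_class :: "int \<Rightarrow> int \<Rightarrow> bool" where
  "isolated_class n r \<longleftrightarrow> (\<exists>p. class_primes n r = {p})"

definition admissible :: "int \<Rightarrow> int multiset \<Rightarrow> bool" where
  "admissible n S \<longleftrightarrow> set_mset S \<subseteq> {0..<n} \<and>
     (\<forall>r\<in>#S. \<not> empty_class n r) \<and> (\<forall>r. isolated_class n r \<longrightarrow> count S r \<le> 1)"

text \<open>The \<open>count S x\<close> copies of \<open>x\<close> are told apart as \<open>(x, 0), (x, 1), \<dots>\<close>, so that the
  subsets of \<open>indexed S\<close> are the sub-multisets of \<open>S\<close> counted with multiplicity.\<close>

definition indexed :: "'a multiset \<Rightarrow> ('a \<times> nat) set" where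
  "indexed S = {(x, i). i < count S x}"

definition iprod :: "(int \<times> nat) set \<Rightarrow> int" where
  "iprod T = (\<Prod>x\<in>T. fst x)"

text \<open>For \<open>m > 0\<close> and \<open>a \<equiv> r + c * m\<close> modulo \<open>2 * m\<close> with \<open>0 \<le> r < m\<close> and \<open>c \<in> {0, 1}\<close>,
  this is \<open>c\<close>.\<close>

definition class_sgn :: "int \<Rightarrow> int \<Rightarrow> int" where
  "class_sgn m a = (a mod (2 * m)) div m"

definition balanced :: "int \<Rightarrow> int multiset \<Rightarrow> bool" where
  "balanced m S \<longleftrightarrow> (\<forall>a\<in>{0..<m}.
     card {T. T \<subseteq> indexed S \<and> [iprod T = a] (mod m) \<and> even (card T)} =
     card {T. T \<subseteq> indexed S \<and> [iprod T = a] (mod m) \<and> odd (card T)})"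

definition signed_balanced :: "int \<Rightarrow> int multiset \<Rightarrow> bool" where
  "signed_balanced m S \<longleftrightarrow> (\<forall>a\<in>{0..<m}.
     card {T. T \<subseteq> indexed S \<and> [iprod T = a] (mod m) \<and>
              even (int (card T) + class_sgn m (iprod T))} =
     card {T. T \<subseteq> indexed S \<and> [iprod T = a] (mod m) \<and>
              odd (int (card T) + class_sgn m (iprod T))})"

definition necklace_system :: "int \<Rightarrow> int multiset \<Rightarrow> bool" where
  "necklace_system m S \<longleftrightarrow> admissible m S \<and> balanced m S"

definition signed_necklace_system :: "int \<Rightarrow> int multiset \<Rightarrow> bool" where
  "signed_necklace_system m S \<longleftrightarrow> admissible (2 * m) S \<and> signed_balanced m S"

definition primitive_necklace_system :: "int \<Rightarrow> int multiset \<Rightarrow> bool" where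
  "primitive_necklace_system m S \<longleftrightarrow>
     necklace_system m S \<and> (\<forall>T. T \<subset># S \<longrightarrow> \<not> necklace_system m T)"

definition primitive_signed_necklace_system :: "int \<Rightarrow> int multiset \<Rightarrow> bool" where
  "primitive_signed_necklace_system m S \<longleftrightarrow>
     signed_necklace_system m S \<and> (\<forall>T. T \<subset># S \<longrightarrow> \<not> signed_necklace_system m T)"

text \<open>The two-element multiset \<open>{m - 1, 2 * m - 1}\<close> is not a primitive signed necklace system for
  every \<open>m \<ge> 2\<close>. For \<open>m = 2\<close> it contains the class of \<open>1\<close>, which is a signed necklace system on its
  own. For odd \<open>m \<ge> 5\<close> all members of the class of \<open>m - 1\<close> modulo \<open>2 * m\<close> are even and none of
  them is \<open>2\<close>, so that class is empty.\<close>

lemma not_primitive_signed_2: "\<not> primitive_signed_necklace_system 2 {#2 - 1, 2 * 2 - 1#}"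
proof -
  have "(5::int) \<in> class_primes 4 1"
    by (simp add: class_primes_def cong_def)
  then have adm: "admissible (2 * 2) {#1#}"
    by (auto simp: admissible_def empty_class_def)
  have ind: "indexed {#1::int#} = {(1, 0)}"
    by (auto simp: indexed_def split: if_splits)
  have "signed_balanced 2 {#1#}"
    unfolding signed_balanced_def
  proof
    fix a :: int assume "a \<in> {0..<2}"
    let ?E = "{T. T \<subseteq> indexed {#1#} \<and> [iprod T = a] (mod 2) \<and>
                even (int (card T) + class_sgn 2 (iprod T))}"
    let ?O = "{T. T \<subseteq> indexed {#1#} \<and> [iprod T = a] (mod 2) \<and>
                odd (int (card T) + class_sgn 2 (iprod T))}"
    have "?E = (if [1 = a] (mod 2) then {{}} else {})"
      unfolding ind by (auto simp: subset_singleton_iff iprod_def class_sgn_def)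
    moreover have "?O = (if [1 = a] (mod 2) then {{(1, 0)}} else {})"
      unfolding ind by (auto simp: subset_singleton_iff iprod_def class_sgn_def)
    ultimately show "card ?E = card ?O"
      by simp
  qed
  with adm have "signed_necklace_system 2 {#1#}"
    by (simp add: signed_necklace_system_def)
  moreover have "{#1#} \<subset># {#2 - 1, 2 * 2 - 1 :: int#}"
    by (simp add: subset_mset_def)
  ultimately show ?thesis
    unfolding primitive_signed_necklace_system_def by blast
qed

lemma not_signed_odd:
  assumes "odd m" "m \<ge> 5"
  shows "\<not> signed_necklace_system m {#m - 1, 2 * m - 1#}"
proof -
  have "empty_class (2 * m) (m - 1)"
  proof (rule ccontr)
    assume "\<not> empty_class (2 * m) (m - 1)"
    then obtain p where p: "prime p" "[p = m - 1] (mod (2 * m))"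
      by (auto simp: empty_class_def class_primes_def)
    then have "[p = m - 1] (mod 2)"
      using cong_modulus_mult by blast
    with \<open>odd m\<close> have "even p"
      by (simp add: cong_dvd_iff)
    with p(1) have "p = 2"
      using primes_dvd_imp_eq[of 2 p] by simp
    with p(2) \<open>m \<ge> 5\<close> show False
      by (simp add: cong_def)
  qed
  then show ?thesis
    by (simp add: signed_necklace_system_def admissible_def)
qed

end

theory Submission
  imports "HOL-Analysis.Analysis" Defs
begin

text \<open>
  Counting subsets with the sign of their parity turns both balancing conditions into a vanishing
  signed sum over the products of all subsets; for at most three elements this is an explicit
  identity between indicator functions of residue classes. Evaluated at the class of \<open>1\<close>, it forces
  an element \<open>\<equiv> 1\<close> (or, in the signed case, a product \<open>\<equiv> 1 + m\<close>), and \<open>{1}\<close> is balanced by itself.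

  That the classes in question contain primes is Dirichlet's theorem. With \<open>\<Lambda>\<close> the von Mangoldt
  function, \<open>L(s, \<psi>) * (\<Sum> \<psi>(n) \<Lambda>(n) n^(-s)) = - L'(s, \<psi>)\<close> for real \<open>s > 1\<close>, so everything
  reduces to \<open>L(1, \<psi>) \<noteq> 0\<close> for nonprincipal characters \<open>\<psi>\<close>. The absolute value of the product of
  all \<open>L(s, \<psi>)\<close> decreases in \<open>s\<close>, hence stays away from \<open>0\<close> as \<open>s\<close> tends to \<open>1\<close>; thus at most one
  \<open>\<psi>\<close> has \<open>L(1, \<psi>) = 0\<close>, and such a \<open>\<psi>\<close> equals its conjugate. Real characters are excluded by
  Monsky's Lambert series argument.
\<close>

section \<open>Dirichlet characters\<close>

text \<open>Condition (i) is what brings in analysis: for an unrestricted modulus, the classes of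
  \<open>m - 1\<close>, of \<open>2 * m - 1\<close> and of every a with a^2 \<equiv> 1 must contain
  a prime, and in general nothing but coprimality to the modulus is known about them. The condition
  on isolated classes is harmless, since the multisets to be certified have distinct elements.

  Three devices shape the analytic part. Neither logarithms nor Euler products of L-series occur: a
  differential equation F' = - g F with real g controls |F|^2 even where F might vanish. There is no
  analytic continuation: Abel summation gives |L(s) - L(1)| \<le> (1 + 2 k)(s - 1), so every zero at
  1 supplies a factor s - 1. The unit group is never decomposed into cyclic factors: characters
  separating a unit from 1 come from simultaneous eigenvectors of the shift operators.\<close>

definition dirichlet_chars :: "nat \<Rightarrow> (nat \<Rightarrow> complex) set" where
  "dirichlet_chars k = {\<psi>. \<psi> 1 = 1 \<and> (\<forall>a b. \<psi> (a * b) = \<psi> a * \<psi> b) \<and>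
     (\<forall>a. \<psi> (a mod k) = \<psi> a) \<and> (\<forall>a. \<psi> a = 0 \<longleftrightarrow> \<not> coprime a k)}"

definition principal_char :: "nat \<Rightarrow> nat \<Rightarrow> complex" where
  "principal_char k a = of_bool (coprime a k)"

context
  fixes k :: nat and \<psi> :: "nat \<Rightarrow> complex"
  assumes k: "k > 0" and char: "\<psi> \<in> dirichlet_chars k"
begin

lemma char_one: "\<psi> 1 = 1"
  and char_mult: "\<psi> (a * b) = \<psi> a * \<psi> b"
  and char_mod: "\<psi> (a mod k) = \<psi> a"
  and char_eq_0_iff: "\<psi> a = 0 \<longleftrightarrow> \<not> coprime a k"
  using char by (auto simp: dirichlet_chars_def)

lemma char_cong: "[a = b] (mod k) \<Longrightarrow> \<psi> a = \<psi> b"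
  by (metis char_mod cong_def)

lemma char_power: "\<psi> (a ^ n) = \<psi> a ^ n"
  using char_one by (induction n) (simp_all add: char_mult)

lemma char_power_totient: "coprime a k \<Longrightarrow> \<psi> a ^ totient k = 1"
  using char_cong[OF euler_theorem[of a k]] char_power[of a "totient k"] char_one by simp

lemma norm_char: "coprime a k \<Longrightarrow> norm (\<psi> a) = 1"
  using char_power_totient[of a] k power_eq_1_iff[of "norm (\<psi> a)" "totient k"]
  by (simp flip: norm_power)

lemma norm_char_le_1: "norm (\<psi> a) \<le> 1"
  using norm_char[of a] char_eq_0_iff[of a] by (cases "coprime a k") auto

text \<open>A unit \<open>g\<close> with \<open>\<psi> g \<noteq> 1\<close> permutes the residues,
  so the sum is unchanged by multiplication with \<open>\<psi> g\<close>.\<close>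

lemma sum_char_eq_0:
  assumes "\<psi> \<noteq> principal_char k"
  shows "(\<Sum>a<k. \<psi> a) = 0"
proof -
  obtain g where g: "coprime g k" "\<psi> g \<noteq> 1"
  proof -
    obtain g where "\<psi> g \<noteq> principal_char k g" using assms by blast
    then show thesis using that[of g] char_eq_0_iff[of g] by (cases "coprime g k") (auto simp: principal_char_def)
  qed
  have bij: "bij_betw (\<lambda>a. (g * a) mod k) {..<k} {..<k}"
  proof -
    have "inj_on (\<lambda>a. (g * a) mod k) {..<k}"
    proof (rule inj_onI)
      fix a b assume ab: "a \<in> {..<k}" "b \<in> {..<k}" and "(g * a) mod k = (g * b) mod k"
      then have "[g * a = g * b] (mod k)" by (simp add: cong_def)
      then have "[a = b] (mod k)" using g(1) cong_mult_lcancel_nat by blast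
      then show "a = b" using ab by (simp add: cong_def)
    qed
    moreover have "(\<lambda>a. (g * a) mod k) ` {..<k} \<subseteq> {..<k}" using k by auto
    ultimately show ?thesis
      by (simp add: bij_betw_def endo_inj_surj)
  qed
  have "(\<Sum>a<k. \<psi> a) = (\<Sum>a<k. \<psi> ((g * a) mod k))"
    by (rule sum.reindex_bij_betw[OF bij, symmetric])
  also have "\<dots> = \<psi> g * (\<Sum>a<k. \<psi> a)"
    by (simp add: char_mod char_mult sum_distrib_left)
  finally show ?thesis using g(2) by simp
qed

text \<open>Whole periods cancel, leaving fewer than \<open>k\<close> terms. This is the constant
  \<open>B\<close> of the Abel summations below.\<close>

lemma norm_sum_char_le:
  assumes "\<psi> \<noteq> principal_char k"
  shows "norm (\<Sum>a<n. \<psi> a) \<le> real k"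
proof (induction n rule: less_induct)
  case (less n)
  show ?case
  proof (cases "n < k")
    case True
    have "norm (\<Sum>a<n. \<psi> a) \<le> (\<Sum>a<n. norm (\<psi> a))" by (rule norm_sum)
    also have "\<dots> \<le> (\<Sum>a<n. 1)" by (intro sum_mono norm_char_le_1)
    finally show ?thesis using True by simp
  next
    case False
    have "(\<Sum>a<n. \<psi> a) = (\<Sum>a<k. \<psi> a) + (\<Sum>a\<in>{k..<n}. \<psi> a)"
      using False sum.atLeastLessThan_concat[of 0 k n \<psi>] by (simp add: atLeast0LessThan)
    also have "(\<Sum>a\<in>{k..<n}. \<psi> a) = (\<Sum>a<n - k. \<psi> (a + k))"
      using False by (simp add: sum.atLeastLessThan_shift_0[of \<psi> k n] atLeast0LessThan add.commute)
    also have "\<dots> = (\<Sum>a<n - k. \<psi> a)"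
      by (intro sum.cong refl) (metis char_mod mod_add_self2)
    finally have "(\<Sum>a<n. \<psi> a) = (\<Sum>a<n - k. \<psi> a)" using sum_char_eq_0[OF assms] by simp
    then show ?thesis using less.IH[of "n - k"] False k by simp
  qed
qed

end

lemma principal_char_in_chars: "k > 0 \<Longrightarrow> principal_char k \<in> dirichlet_chars k"
  by (auto simp: dirichlet_chars_def principal_char_def)

lemma char_mult_closed:
  "\<lbrakk>\<psi> \<in> dirichlet_chars k; \<phi> \<in> dirichlet_chars k\<rbrakk> \<Longrightarrow> (\<lambda>a. \<psi> a * \<phi> a) \<in> dirichlet_chars k"
  by (auto simp: dirichlet_chars_def)

lemma char_cnj_closed:
  "\<psi> \<in> dirichlet_chars k \<Longrightarrow> (\<lambda>a. cnj (\<psi> a)) \<in> dirichlet_chars k"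
  by (auto simp: dirichlet_chars_def)

text \<open>The values on \<open>{..<k}\<close> determine a character, and each is 0 or a root of
  unity of order dividing \<open>totient k\<close>.\<close>

lemma finite_dirichlet_chars:
  assumes "k > 0" shows "finite (dirichlet_chars k)"
proof -
  let ?R = "insert 0 {z :: complex. z ^ totient k = 1}"
  have "inj_on (\<lambda>\<psi>. restrict \<psi> {..<k}) (dirichlet_chars k)"
  proof (rule inj_onI, rule ext)
    fix \<psi> \<phi> a
    assume c: "\<psi> \<in> dirichlet_chars k" "\<phi> \<in> dirichlet_chars k" "restrict \<psi> {..<k} = restrict \<phi> {..<k}"
    have "\<psi> (a mod k) = \<phi> (a mod k)" using fun_cong[OF c(3), of "a mod k"] assms by simp
    then show "\<psi> a = \<phi> a" using char_mod[OF assms c(1)] char_mod[OF assms c(2)] by simp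
  qed
  moreover have "(\<lambda>\<psi>. restrict \<psi> {..<k}) ` dirichlet_chars k \<subseteq> (\<Pi>\<^sub>E a\<in>{..<k}. ?R)"
  proof (intro image_subsetI restrict_PiE_iff[THEN iffD2] ballI)
    fix \<psi> a assume "\<psi> \<in> dirichlet_chars k"
    then show "\<psi> a \<in> ?R"
      using char_power_totient[OF assms, of \<psi> a] char_eq_0_iff[OF assms, of \<psi> a] by auto
  qed
  moreover have "finite (\<Pi>\<^sub>E a\<in>{..<k}. ?R)"
    using assms by (intro finite_PiE) (auto intro!: finite_roots_unity simp: Suc_le_eq)
  ultimately show ?thesis by (metis finite_imageD finite_subset)
qed


section \<open>Separating characters from eigenvectors of shifts\<close>

definition shift_proj :: "nat \<Rightarrow> nat \<Rightarrow> nat \<Rightarrow> (nat \<Rightarrow> complex) \<Rightarrow> nat \<Rightarrow> complex" where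
  "shift_proj n h j f x = (\<Sum>i<n. cis (2 * pi * real j / real n) ^ i * f (h ^ i * x))"

lemma cis_root_power: "n > 0 \<Longrightarrow> cis (2 * pi * real j / real n) ^ n = 1"
  using cis_multiple_2pi[of "real j"] by (simp add: Complex.DeMoivre)

lemma cis_root_neq_1:
  assumes "0 < i" "i < n" shows "cis (2 * pi * real i / real n) \<noteq> 1"
proof
  assume "cis (2 * pi * real i / real n) = 1"
  then have "cis (2 * pi * real i / real n) = cis (2 * pi * real 0 / real n)" by simp
  with Complex.bij_betw_roots_unity[of n] have "i = 0"
    using assms by (auto simp: bij_betw_def dest!: inj_onD[where x = i and y = 0])
  then show False using assms by simp
qed

text \<open>\<open>shift_proj n h j\<close> is \<open>n\<close> times the projection onto an
  eigenspace of the shift by \<open>h\<close>, provided \<open>h ^ n\<close> acts trivially: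
  multiplication by the root of unity \<open>u\<close> moves the summation index by one, and the two
  end terms agree because \<open>u ^ n = 1\<close>.\<close>

lemma shift_proj_eigen:
  assumes n: "n > 0" and per: "\<And>x. f (h ^ n * x) = f x"
  shows "shift_proj n h j f (h * x) = inverse (cis (2 * pi * real j / real n)) * shift_proj n h j f x"
proof -
  let ?u = "cis (2 * pi * real j / real n)"
  define F where "F i = ?u ^ i * f (h ^ i * x)" for i
  have "?u * shift_proj n h j f (h * x) = (\<Sum>i<n. F (Suc i))"
    by (simp add: shift_proj_def F_def sum_distrib_left mult_ac)
  also have "\<dots> = (\<Sum>i<n. F i) + (F n - F 0)"
    using sum.lessThan_Suc_shift[of F n] by (simp add: algebra_simps)
  also have "F n = F 0" using n by (simp add: F_def per cis_root_power)
  finally have "?u * shift_proj n h j f (h * x) = shift_proj n h j f x"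
    by (simp add: F_def shift_proj_def)
  then show ?thesis by (metis cis_neq_zero left_inverse mult.assoc mult_1)
qed

text \<open>Power sums of the \<open>n\<close>-th roots of unity vanish for exponents strictly
  between 0 and \<open>n\<close>. So wherever \<open>f\<close> is nonzero, some eigencomponent is
  nonzero too.\<close>

lemma sum_shift_proj:
  assumes n: "n > 0"
  shows "(\<Sum>j<n. shift_proj n h j f x) = of_nat n * f x"
proof -
  have geom: "(\<Sum>j<n. cis (2 * pi * real j / real n) ^ i) = (if i = 0 then of_nat n else 0)" if "i < n" for i
  proof (cases "i = 0")
    case False
    have "cis (2 * pi * real j / real n) ^ i = cis (2 * pi * real i / real n) ^ j" for j
      by (simp add: Complex.DeMoivre mult_ac)
    then have "(\<Sum>j<n. cis (2 * pi * real j / real n) ^ i) = (\<Sum>j<n. cis (2 * pi * real i / real n) ^ j)"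
      by simp
    also have "\<dots> = 0"
      using cis_root_neq_1[of i n] False that n cis_root_power[OF n, of i] by (subst geometric_sum) auto
    finally show ?thesis using False by simp
  qed auto
  have "(\<Sum>j<n. shift_proj n h j f x) = (\<Sum>i<n. \<Sum>j<n. cis (2 * pi * real j / real n) ^ i * f (h ^ i * x))"
    unfolding shift_proj_def by (rule sum.swap)
  also have "\<dots> = (\<Sum>i<n. (\<Sum>j<n. cis (2 * pi * real j / real n) ^ i) * f (h ^ i * x))"
    by (simp add: sum_distrib_right)
  also have "\<dots> = (\<Sum>i<n. if i = 0 then of_nat n * f x else 0)"
    by (rule sum.cong) (auto simp: geom)
  also have "\<dots> = of_nat n * f x" using n by simp
  finally show ?thesis .
qed

lemma shift_proj_nonzero:
  assumes "n > 0" "f x \<noteq> 0" shows "\<exists>j<n. shift_proj n h j f x \<noteq> 0"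
  using sum_shift_proj[OF assms(1), of h f x] assms by (metis lessThan_iff mult_eq_0_iff of_nat_eq_0_iff order_less_irrefl sum.neutral)

text \<open>Functions on the unit group modulo \<open>k\<close>, extended by zero: the space on
  which the shifts by units act with finite order.\<close>

definition unit_fun :: "nat \<Rightarrow> (nat \<Rightarrow> complex) \<Rightarrow> bool" where
  "unit_fun k f \<longleftrightarrow> (\<forall>a. f (a mod k) = f a) \<and> (\<forall>a. \<not> coprime a k \<longrightarrow> f a = 0)"

lemma unit_fun_cong: "unit_fun k f \<Longrightarrow> [a = b] (mod k) \<Longrightarrow> f a = f b"
  by (metis unit_fun_def cong_def)

lemma unit_fun_period:
  assumes "unit_fun k f" "coprime h k" shows "f (h ^ totient k * x) = f x"
  using cong_scalar_right[OF euler_theorem[OF assms(2)], of x] unit_fun_cong[OF assms(1)] by simp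

lemma unit_fun_shift_proj:
  assumes "unit_fun k f" shows "unit_fun k (shift_proj n h j f)"
proof -
  have "f (h ^ i * (a mod k)) = f (h ^ i * a)" for i a
    using unit_fun_cong[OF assms, of "h ^ i * (a mod k)" "h ^ i * a"] by (simp add: cong_def mod_mult_right_eq)
  moreover have "f (h ^ i * a) = 0" if "\<not> coprime a k" for i a
    using assms that by (simp add: unit_fun_def)
  ultimately show ?thesis by (simp add: unit_fun_def shift_proj_def)
qed

text \<open>The shifts by units commute and have finite order, so projecting successively onto eigenspaces
  yields a common eigenvector; its values are those of a character.\<close>

lemma common_eigenvector:
  assumes "k > 0" "finite A" "\<forall>h\<in>A. coprime h k" "unit_fun k f" "f y \<noteq> 0" "\<forall>x. f (g * x) = l * f x"
  shows "\<exists>f'. unit_fun k f' \<and> f' y \<noteq> 0 \<and> (\<forall>x. f' (g * x) = l * f' x) \<and> (\<forall>h\<in>A. \<exists>\<mu>. \<forall>x. f' (h * x) = \<mu> * f' x)"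
  using assms(2,3)
proof (induction A rule: finite_induct)
  case empty
  then show ?case using assms by auto
next
  case (insert h A)
  then obtain f' where f': "unit_fun k f'" "f' y \<noteq> 0" "\<forall>x. f' (g * x) = l * f' x"
    "\<forall>h\<in>A. \<exists>\<mu>. \<forall>x. f' (h * x) = \<mu> * f' x" by auto
  let ?n = "totient k"
  have n: "?n > 0" using assms(1) by simp
  obtain j where j: "shift_proj ?n h j f' y \<noteq> 0" using shift_proj_nonzero[OF n, of f' y h] f'(2) by blast
  have pres: "shift_proj ?n h j f' (a * x) = \<mu> * shift_proj ?n h j f' x" if "\<forall>x. f' (a * x) = \<mu> * f' x" for a \<mu> x
    using that by (simp add: shift_proj_def sum_distrib_left mult.left_commute[of _ a] mult.left_commute[of _ \<mu>])
  have "\<forall>x. shift_proj ?n h j f' (h * x) = inverse (cis (2 * pi * real j / real ?n)) * shift_proj ?n h j f' x"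
    using shift_proj_eigen[OF n, of f' h] unit_fun_period[OF f'(1)] insert.prems by simp
  with pres f' j unit_fun_shift_proj[OF f'(1)] show ?case
    by (intro exI[of _ "shift_proj ?n h j f'"]) (blast elim: ballE)
qed

text \<open>If a function is nonzero at 1 but its component for the eigenvalue 1 of the shift by
  \<open>g\<close> vanishes there, then a component for another eigenvalue survives. A common
  eigenvector refining it, divided by its value at 1, is a character whose value at \<open>g\<close>
  is that eigenvalue.\<close>

lemma exists_separating_char:
  assumes k: "k > 1" and g: "coprime g k" "\<not> [g = 1] (mod k)"
  shows "\<exists>\<psi>\<in>dirichlet_chars k. \<psi> g \<noteq> 1"
proof -
  let ?n = "totient k"
  have n: "?n > 0" using k by simp
  \<comment> \<open>A point mass at 1 minus its shift by \<open>g\<close>: the sum over the powers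
    of \<open>g\<close> telescopes, which kills the component with \<open>j = 0\<close> at
    1.\<close>
  define f0 :: "nat \<Rightarrow> complex" where "f0 x = of_bool ([x = 1] (mod k)) - of_bool ([g * x = 1] (mod k))" for x
  have f0: "unit_fun k f0"
  proof -
    have "coprime a k" if "[a = 1] (mod k)" for a
      using cong_imp_coprime[OF cong_sym[OF that]] by simp
    then have "\<not> [a = 1] (mod k) \<and> \<not> [g * a = 1] (mod k)" if "\<not> coprime a k" for a
      using that coprime_mult_left_iff by blast
    then show ?thesis by (auto simp: unit_fun_def f0_def cong_def mod_mult_right_eq)
  qed
  have f01: "f0 1 \<noteq> 0" using g(2) by (simp add: f0_def)
  obtain j where j: "j < ?n" "shift_proj ?n g j f0 1 \<noteq> 0" using shift_proj_nonzero[OF n, of f0 1 g] f01 by blast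
  have "j \<noteq> 0"
  proof
    assume "j = 0"
    define d :: "nat \<Rightarrow> complex" where "d i = of_bool ([g ^ i = 1] (mod k))" for i
    have "shift_proj ?n g j f0 1 = (\<Sum>i<?n. d i - d (Suc i))"
      using \<open>j = 0\<close> by (simp add: shift_proj_def f0_def d_def)
    also have "\<dots> = d 0 - d ?n" by (rule sum_lessThan_telescope')
    also have "\<dots> = 0" using euler_theorem[OF g(1)] by (simp add: d_def)
    finally show False using j by simp
  qed
  let ?l = "inverse (cis (2 * pi * real j / real ?n))"
  have l: "?l \<noteq> 1" using cis_root_neq_1[of j ?n] \<open>j \<noteq> 0\<close> j(1) inverse_eq_1_iff by blast
  have eig: "\<forall>x. shift_proj ?n g j f0 (g * x) = ?l * shift_proj ?n g j f0 x"
    using shift_proj_eigen[OF n, of f0 g] unit_fun_period[OF f0 g(1)] by simp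
  let ?A = "{h. h < k \<and> coprime h k}"
  have "0 < k" "finite ?A" "\<forall>h\<in>?A. coprime h k" using k by auto
  from common_eigenvector[OF this unit_fun_shift_proj[OF f0] j(2) eig]
  obtain f where f: "unit_fun k f" "f 1 \<noteq> 0" "\<forall>x. f (g * x) = ?l * f x"
      "\<forall>h\<in>?A. \<exists>\<mu>. \<forall>x. f (h * x) = \<mu> * f x"
    by (elim exE conjE)
  \<comment> \<open>Comparing the eigenvalue equation at \<open>x\<close> and at 1 shows that the
    eigenvalue of \<open>h\<close> is \<open>f h / f 1\<close>; this is multiplicativity after
    division by \<open>f 1\<close>.\<close>
  have eigen: "f (h * x) * f 1 = f h * f x" for h x
  proof (cases "coprime h k")
    case True
    then have "h mod k \<in> ?A" using k by simp
    then obtain \<mu> where \<mu>: "\<And>x. f (h mod k * x) = \<mu> * f x" using f(4) by blast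
    have "f (h * x) = \<mu> * f x" for x
      using \<mu>[of x] unit_fun_cong[OF f(1), of "h mod k * x" "h * x"] by (simp add: cong_def mod_mult_left_eq)
    from this[of x] this[of 1] show ?thesis by simp
  next
    case False
    then show ?thesis using f(1) by (simp add: unit_fun_def)
  qed
  have nz: "f a \<noteq> 0" if a: "coprime a k" for a
  proof
    assume "f a = 0"
    obtain b where "[a * b = 1] (mod k)" using cong_solve_coprime_nat[OF a] by auto
    then have "f (a * b) = f 1" by (rule unit_fun_cong[OF f(1)])
    then show False using eigen[of a b] \<open>f a = 0\<close> f(2) by simp
  qed
  have "(\<lambda>a. f a / f 1) \<in> dirichlet_chars k"
    using f(1,2) eigen nz by (auto simp: dirichlet_chars_def unit_fun_def field_simps)
  moreover have "f g / f 1 \<noteq> 1" using f(2,3) l by (metis divide_eq_1_iff mult_1_right mult_cancel_right1)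
  ultimately show ?thesis by (intro bexI[of _ "\<lambda>a. f a / f 1"])
qed

section \<open>Orthogonality of characters\<close>

lemma sum_chars_at:
  assumes k: "k > 1"
  shows "(\<Sum>\<psi>\<in>dirichlet_chars k. \<psi> a) = (if [a = 1] (mod k) then of_nat (card (dirichlet_chars k)) else 0)"
proof -
  have k0: "k > 0" using k by simp
  consider "[a = 1] (mod k)" | "\<not> coprime a k" "\<not> [a = 1] (mod k)" | "coprime a k" "\<not> [a = 1] (mod k)" by blast
  then show ?thesis
  proof cases
    case 1
    then have "\<psi> a = 1" if "\<psi> \<in> dirichlet_chars k" for \<psi>
      using char_cong[OF k0 that 1] char_one[OF k0 that] by simp
    then have "(\<Sum>\<psi>\<in>dirichlet_chars k. \<psi> a) = (\<Sum>\<psi>\<in>dirichlet_chars k. 1)" by (rule sum.cong[OF refl])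
    then show ?thesis using 1 by simp
  next
    case 2
    then have "\<psi> a = 0" if "\<psi> \<in> dirichlet_chars k" for \<psi>
      using char_eq_0_iff[OF k0 that] by simp
    then show ?thesis using 2 by (simp add: sum.neutral)
  next
    case 3
    obtain \<phi> where \<phi>: "\<phi> \<in> dirichlet_chars k" "\<phi> a \<noteq> 1" using exists_separating_char[OF k 3] by blast
    have inv: "\<phi> x * cnj (\<phi> x) * \<psi> x = \<psi> x" if "\<psi> \<in> dirichlet_chars k" for \<psi> x
    proof (cases "coprime x k")
      case True
      then show ?thesis using norm_char[OF k0 \<phi>(1), of x] complex_norm_square[of "\<phi> x"] by simp
    next
      case False
      then show ?thesis using char_eq_0_iff[OF k0 that] by simp
    qed
    \<comment> \<open>Multiplication by \<open>\<phi>\<close> permutes the characters, with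
      multiplication by its conjugate as inverse. The product of the two is only the principal
      character, but every character vanishes off the units anyway.\<close>
    have "(\<Sum>\<psi>\<in>dirichlet_chars k. \<psi> a) = (\<Sum>\<psi>\<in>dirichlet_chars k. \<phi> a * \<psi> a)"
      by (rule sum.reindex_bij_witness[of _ "\<lambda>\<psi> x. \<phi> x * \<psi> x" "\<lambda>\<psi> x. cnj (\<phi> x) * \<psi> x"])
        (use inv in \<open>auto intro!: char_mult_closed \<phi> char_cnj_closed simp: mult.assoc mult.left_commute\<close>)
    also have "\<dots> = \<phi> a * (\<Sum>\<psi>\<in>dirichlet_chars k. \<psi> a)" by (simp add: sum_distrib_left)
    finally have "(\<Sum>\<psi>\<in>dirichlet_chars k. \<psi> a) = 0" using \<phi>(2) by simp
    then show ?thesis using 3 by simp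
  qed
qed

text \<open>\<open>cnj (\<psi> l)\<close> equals \<open>\<psi> b\<close> for an inverse
  \<open>b\<close> of \<open>l\<close> modulo \<open>k\<close>, which reduces everything to the
  class of 1.\<close>

lemma sum_chars_cnj_mult:
  assumes k: "k > 1" and l: "coprime l k"
  shows "(\<Sum>\<psi>\<in>dirichlet_chars k. cnj (\<psi> l) * \<psi> a) =
     (if [a = l] (mod k) then of_nat (card (dirichlet_chars k)) else 0)"
proof -
  have k0: "k > 0" using k by simp
  obtain b where b: "[l * b = 1] (mod k)" using cong_solve_coprime_nat[OF l] by auto
  have "cnj (\<psi> l) * \<psi> a = \<psi> (b * a)" if "\<psi> \<in> dirichlet_chars k" for \<psi>
  proof -
    have "\<psi> l * \<psi> b = 1"
      using char_cong[OF k0 that b] char_one[OF k0 that] char_mult[OF k0 that, of l b] by simp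
    moreover have "\<psi> l * cnj (\<psi> l) = 1"
      using norm_char[OF k0 that l] complex_norm_square[of "\<psi> l"] by simp
    ultimately have "cnj (\<psi> l) = \<psi> b" by (metis mult_left_cancel mult_zero_left zero_neq_one)
    then show ?thesis using char_mult[OF k0 that, of b a] by simp
  qed
  then have "(\<Sum>\<psi>\<in>dirichlet_chars k. cnj (\<psi> l) * \<psi> a) = (\<Sum>\<psi>\<in>dirichlet_chars k. \<psi> (b * a))"
    by (rule sum.cong[OF refl])
  moreover have "[b * a = 1] (mod k) \<longleftrightarrow> [a = l] (mod k)"
  proof
    assume "[b * a = 1] (mod k)"
    then have "[l * (b * a) = l * 1] (mod k)" by (rule cong_scalar_left)
    moreover have "[l * b * a = 1 * a] (mod k)" using b by (rule cong_scalar_right)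
    ultimately show "[a = l] (mod k)" by (simp add: cong_def mult.assoc)
  next
    assume "[a = l] (mod k)"
    then have "[b * a = b * l] (mod k)" by (rule cong_scalar_left)
    then show "[b * a = 1] (mod k)" using b by (simp add: cong_def mult.commute)
  qed
  ultimately show ?thesis by (simp add: sum_chars_at[OF k])
qed

section \<open>Dirichlet series\<close>

text \<open>Pairs of positive integers are regrouped by their product. This serves both Dirichlet
  convolution and the Lambert series.\<close>

lemma has_sum_divisors:
  fixes g :: "nat \<times> nat \<Rightarrow> complex"
  assumes "(g has_sum S) ({0<..} \<times> {0<..})"
  shows "((\<lambda>n. \<Sum>d | d dvd n. g (d, n div d)) has_sum S) {0<..}"
proof (rule has_sum_SigmaD)
  show "((\<lambda>(n, d). g (d, n div d)) has_sum S) (Sigma {0<..} (\<lambda>n. {d. d dvd n}))"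
    using assms
    by (subst has_sum_reindex_bij_witness[of _ "\<lambda>(a, b). (a * b, a)" "\<lambda>(n, d). (d, n div d)" "{0<..} \<times> {0<..}" g])
      (auto elim!: dvdE)
  show "((\<lambda>d. case (n, d) of (n, d) \<Rightarrow> g (d, n div d)) has_sum (\<Sum>d | d dvd n. g (d, n div d))) {d. d dvd n}"
    if "n \<in> {0<..}" for n
    using that by (auto intro!: has_sum_finite)
qed

lemma has_sum_mult_pairs:
  fixes x y :: "nat \<Rightarrow> 'a :: {real_normed_field, banach}"
  assumes "(\<lambda>i. norm (x i)) summable_on A" "(\<lambda>j. norm (y j)) summable_on B" "(x has_sum X) A" "(y has_sum Y) B"
  shows "((\<lambda>(i, j). x i * y j) has_sum (X * Y)) (A \<times> B)"
proof (rule has_sum_SigmaI)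
  show "((\<lambda>j. case (i, j) of (i, j) \<Rightarrow> x i * y j) has_sum (x i * Y)) B" for i
    using has_sum_cmult_right[OF assms(4)] by simp
  show "((\<lambda>i. x i * Y) has_sum (X * Y)) A"
    using has_sum_cmult_left[OF assms(3)] by simp
  have "(\<lambda>p. norm (case p of (i, j) \<Rightarrow> x i * y j)) summable_on (A \<times> B)"
    using assms(1,2)
    by (auto simp: Infinite_Sum.abs_summable_on_Sigma_iff norm_mult infsum_cmult_right' abs_mult
        intro!: summable_on_cmult_right summable_on_cmult_left)
  then show "(\<lambda>(i, j). x i * y j) summable_on (A \<times> B)"
    by (rule Infinite_Sum.abs_summable_summable)
qed

lemma has_sum_positive_iff:
  fixes f :: "nat \<Rightarrow> 'a :: {comm_monoid_add, topological_space}"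
  assumes "f 0 = 0" shows "(f has_sum S) {0<..} \<longleftrightarrow> (f has_sum S) UNIV"
  by (rule has_sum_cong_neutral) (use assms in auto)

text \<open>The term for \<open>n = 0\<close> vanishes because \<open>0 powr x = 0\<close>.\<close>

definition dseries :: "(nat \<Rightarrow> complex) \<Rightarrow> complex \<Rightarrow> complex" where
  "dseries a z = (\<Sum>n. a n * of_nat n powr (- z))"

lemma nat_powr_of_real: "(of_nat n :: complex) powr (- of_real s) = of_real (real n powr (- s))"
  using powr_of_real[of "real n" "- s"] by simp

lemma norm_nat_powr: "norm ((of_nat n :: complex) powr (- z)) = real n powr (- Re z)"
  by (cases "n = 0") (auto simp: norm_powr_real_powr)

lemma dseries_mult:
  assumes "summable (\<lambda>n. norm (a n) * real n powr (- Re z))" "summable (\<lambda>n. norm (b n) * real n powr (- Re z))"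
  shows "dseries a z * dseries b z = dseries (\<lambda>n. \<Sum>d | d dvd n. a d * b (n div d)) z"
proof -
  let ?p = "\<lambda>n. (of_nat n :: complex) powr (- z)"
  have *: "((\<lambda>n. c n * ?p n) has_sum dseries c z) {0<..}" "(\<lambda>n. norm (c n * ?p n)) summable_on {0<..}"
    if "summable (\<lambda>n. norm (c n) * real n powr (- Re z))" for c
  proof -
    have s: "summable (\<lambda>n. norm (c n * ?p n))" using that by (simp add: norm_mult norm_nat_powr)
    have "((\<lambda>n. c n * ?p n) has_sum dseries c z) UNIV"
      unfolding dseries_def by (rule norm_summable_imp_has_sum[OF s summable_sums[OF summable_norm_cancel[OF s]]])
    then show "((\<lambda>n. c n * ?p n) has_sum dseries c z) {0<..}" by (subst has_sum_positive_iff) auto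
    have "(\<lambda>n. norm (c n * ?p n)) summable_on UNIV"
      using s by (intro norm_summable_imp_summable_on) simp
    then show "(\<lambda>n. norm (c n * ?p n)) summable_on {0<..}" by (rule summable_on_subset_banach) simp
  qed
  from has_sum_divisors[OF has_sum_mult_pairs[OF *(2)[OF assms(1)] *(2)[OF assms(2)] *(1)[OF assms(1)] *(1)[OF assms(2)]]]
  have "((\<lambda>n. \<Sum>d | d dvd n. (a d * ?p d) * (b (n div d) * ?p (n div d))) has_sum (dseries a z * dseries b z)) {0<..}"
    by simp
  also have "?this \<longleftrightarrow> ((\<lambda>n. (\<Sum>d | d dvd n. a d * b (n div d)) * ?p n) has_sum (dseries a z * dseries b z)) {0<..}"
  proof (rule has_sum_cong)
    fix n :: nat assume "n \<in> {0<..}"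
    have "?p d * ?p (n div d) = ?p n" if dn: "d dvd n" for d
    proof -
      obtain e where "n = d * e" using dn by blast
      then show ?thesis using \<open>n \<in> {0<..}\<close> by (simp add: powr_times_real)
    qed
    then show "(\<Sum>d | d dvd n. (a d * ?p d) * (b (n div d) * ?p (n div d))) = (\<Sum>d | d dvd n. a d * b (n div d)) * ?p n"
      unfolding sum_distrib_right by (intro sum.cong refl) (auto simp: mult_ac)
  qed
  finally have "((\<lambda>n. (\<Sum>d | d dvd n. a d * b (n div d)) * ?p n) has_sum (dseries a z * dseries b z)) UNIV"
    by (subst (asm) has_sum_positive_iff) auto
  then show ?thesis unfolding dseries_def using has_sum_imp_sums sums_unique by fastforce
qed

lemma summable_ln_powr:
  assumes "s > 1" shows "summable (\<lambda>n. ln (real n) * real n powr (- s))"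
proof (rule summable_comparison_test_ev)
  \<comment> \<open>Half of the excess \<open>s - 1\<close> absorbs the logarithm, via
    \<open>ln n \<le> n powr e / e\<close>; the other half keeps the exponent below -1.\<close>
  define e where "e = (s - 1) / 2"
  have e: "e > 0" "e - s < - 1" using assms by (simp_all add: e_def field_simps)
  show "\<forall>\<^sub>F n in sequentially. norm (ln (real n) * real n powr (- s)) \<le> (1 / e) * real n powr (e - s)"
  proof (rule eventually_sequentiallyI)
    fix n :: nat assume "n \<ge> 1"
    then have "ln (real n) * real n powr (- s) \<le> (real n powr e / e) * real n powr (- s)"
      using e by (intro mult_right_mono ln_powr_bound) auto
    then show "norm (ln (real n) * real n powr (- s)) \<le> (1 / e) * real n powr (e - s)"
      using \<open>n \<ge> 1\<close> by (simp add: powr_diff powr_minus field_simps)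
  qed
  show "summable (\<lambda>n. (1 / e) * real n powr (e - s))"
    using e by (intro summable_mult) (simp add: summable_real_powr_iff)
qed

lemma dseries_has_derivative:
  assumes a: "\<And>n. norm (a n) \<le> 1" and z: "Re z > 1"
  shows "(dseries a has_field_derivative - dseries (\<lambda>n. a n * of_real (ln (real n))) z) (at z)"
proof -
  \<comment> \<open>The half-plane to the right of \<open>s\<close> contains \<open>z\<close> in its
    interior, while \<open>s > 1\<close> still gives a summable majorant for the differentiated
    terms.\<close>
  define s where "s = (1 + Re z) / 2"
  have s: "s > 1" "s < Re z" using z by (simp_all add: s_def)
  define S where "S = {w. Re w > s}"
  let ?f = "\<lambda>n w. a n * of_nat n powr (- w)"
  let ?f' = "\<lambda>n w. - (a n * of_real (ln (real n)) * of_nat n powr (- w))"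
  have S: "convex S" "open S" "z \<in> S" using s by (auto simp: S_def convex_halfspace_Re_gt open_halfspace_Re_gt)
  have mono: "real n powr (- Re w) \<le> real n powr (- s)" if "w \<in> S" for n w
    using that by (cases "n = 0") (auto simp: S_def intro: powr_mono)
  have 1: "(?f n has_field_derivative ?f' n w) (at w within S)" if "w \<in> S" for n w
  proof (cases "n = 0")
    case False
    have "((\<lambda>w. (of_nat n :: complex) powr (- w)) has_field_derivative (Ln (of_nat n) * of_nat n powr (- w)) * (- 1)) (at w within S)"
      by (rule DERIV_chain2[OF has_field_derivative_powr_right])
        (use False in \<open>auto intro!: derivative_eq_intros\<close>)
    from DERIV_cmult[OF this, of "a n"] show ?thesis
      using False by (simp add: Ln_of_nat mult.assoc)
  qed simp
  have 2: "uniformly_convergent_on S (\<lambda>N w. \<Sum>n<N. ?f' n w)"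
  proof (rule Weierstrass_m_test')
    fix n w assume w: "w \<in> S"
    have "norm (?f' n w) = norm (a n) * (\<bar>ln (real n)\<bar> * real n powr (- Re w))"
      by (simp add: norm_mult norm_nat_powr)
    also have "\<dots> \<le> 1 * (\<bar>ln (real n)\<bar> * real n powr (- s))"
      using a mono[OF w] by (intro mult_mono) auto
    also have "\<dots> = ln (real n) * real n powr (- s)" by (cases "n = 0") auto
    finally show "norm (?f' n w) \<le> ln (real n) * real n powr (- s)" .
  qed (rule summable_ln_powr[OF s(1)])
  have 3: "summable (\<lambda>n. ?f n z)"
  proof (rule summable_comparison_test)
    show "\<exists>N. \<forall>n\<ge>N. norm (?f n z) \<le> real n powr (- Re z)"
      using a by (auto simp: norm_mult norm_nat_powr intro!: mult_left_le_one_le)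
  qed (use z in \<open>simp add: summable_real_powr_iff\<close>)
  have "((\<lambda>w. \<Sum>n. ?f n w) has_field_derivative (\<Sum>n. ?f' n z)) (at z)"
    using S by (intro has_field_derivative_series'(2)[OF S(1) 1 2 S(3) 3]) (auto simp: interior_open)
  moreover have "(\<Sum>n. ?f' n z) = - dseries (\<lambda>n. a n * of_real (ln (real n))) z"
  proof -
    have "summable (\<lambda>n. a n * of_real (ln (real n)) * of_nat n powr (- z))"
    proof (rule summable_comparison_test)
      show "\<exists>N. \<forall>n\<ge>N. norm (a n * of_real (ln (real n)) * of_nat n powr (- z)) \<le> ln (real n) * real n powr (- Re z)"
      proof (intro exI allI impI)
        fix n
        have "norm (a n * of_real (ln (real n)) * of_nat n powr (- z)) = norm (a n) * (\<bar>ln (real n)\<bar> * real n powr (- Re z))"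
          by (simp add: norm_mult norm_nat_powr)
        also have "\<dots> \<le> 1 * (\<bar>ln (real n)\<bar> * real n powr (- Re z))"
          using a by (intro mult_right_mono) auto
        also have "\<dots> = ln (real n) * real n powr (- Re z)" by (cases "n = 0") auto
        finally show "norm (a n * of_real (ln (real n)) * of_nat n powr (- z)) \<le> ln (real n) * real n powr (- Re z)" .
      qed
    qed (rule summable_ln_powr[OF z])
    then show ?thesis unfolding dseries_def by (rule suminf_minus)
  qed
  ultimately show ?thesis by (simp add: dseries_def[abs_def])
qed

section \<open>Abel summation and estimates uniform down to s = 1\<close>

lemma norm_abel_sum_le:
  fixes \<psi> :: "nat \<Rightarrow> complex" and a :: "nat \<Rightarrow> real"
  assumes B: "\<And>n. norm (\<Sum>i<n. \<psi> i) \<le> B"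
    and anti: "\<And>i. i \<ge> m \<Longrightarrow> a (Suc i) \<le> a i" and nonneg: "\<And>i. i \<ge> m \<Longrightarrow> 0 \<le> a i"
  shows "norm (\<Sum>i\<in>{m..<n}. \<psi> i * of_real (a i)) \<le> 2 * B * a m"
proof (cases "m \<le> n")
  case True
  define P where "P n = (\<Sum>i\<in>{m..<n}. \<psi> i)" for n
  have P: "norm (P n) \<le> 2 * B" if "m \<le> n" for n
  proof -
    have "P n = (\<Sum>i<n. \<psi> i) - (\<Sum>i<m. \<psi> i)"
      using that by (simp add: P_def lessThan_atLeast0 sum_diff_nat_ivl)
    then have "norm (P n) \<le> norm (\<Sum>i<n. \<psi> i) + norm (\<Sum>i<m. \<psi> i)" by (simp add: norm_triangle_ineq4)
    then show ?thesis using B[of n] B[of m] by linarith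
  qed
  \<comment> \<open>Summation by parts as an invariant: the step from \<open>n\<close> to
    \<open>Suc n\<close> costs at most \<open>2 * B * (a n - a (Suc n))\<close>, and these costs
    telescope. The 2 is due to a block sum being a difference of two partial sums.\<close>
  have "norm ((\<Sum>i\<in>{m..<n}. \<psi> i * of_real (a i)) - of_real (a n) * P n) \<le> 2 * B * (a m - a n)"
    using True
  proof (induction n rule: dec_induct)
    case base
    then show ?case by (simp add: P_def)
  next
    case (step n)
    have "(\<Sum>i\<in>{m..<Suc n}. \<psi> i * of_real (a i)) - of_real (a (Suc n)) * P (Suc n) =
       ((\<Sum>i\<in>{m..<n}. \<psi> i * of_real (a i)) - of_real (a n) * P n) + of_real (a n - a (Suc n)) * P (Suc n)"
      using step by (simp add: P_def algebra_simps)
    also have "norm \<dots> \<le> 2 * B * (a m - a n) + norm (of_real (a n - a (Suc n)) * P (Suc n))"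
      using step.IH norm_triangle_ineq order_trans add_right_mono by blast
    also have "norm (of_real (a n - a (Suc n)) * P (Suc n)) = (a n - a (Suc n)) * norm (P (Suc n))"
      using anti[of n] step by (simp add: norm_mult del: of_real_diff)
    also have "\<dots> \<le> (a n - a (Suc n)) * (2 * B)"
      using anti[of n] step P[of "Suc n"] by (intro mult_left_mono) auto
    finally show ?case by (simp add: algebra_simps)
  qed
  then have "norm (\<Sum>i\<in>{m..<n}. \<psi> i * of_real (a i)) \<le> 2 * B * (a m - a n) + norm (of_real (a n) * P n)"
    using norm_triangle_sub order_trans add_right_mono by (smt (verit))
  also have "norm (of_real (a n) * P n) \<le> a n * (2 * B)"
    using nonneg[OF True] P[OF True] by (simp add: norm_mult mult_left_mono)
  finally show ?thesis by (simp add: algebra_simps)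
next
  case False
  have "B \<ge> 0" using B[of 0] by simp
  then show ?thesis using False nonneg[of m] by simp
qed

lemma summable_abel:
  fixes \<psi> :: "nat \<Rightarrow> complex" and a :: "nat \<Rightarrow> real"
  assumes B: "\<And>n. norm (\<Sum>i<n. \<psi> i) \<le> B"
    and anti: "\<And>i. i \<ge> m \<Longrightarrow> a (Suc i) \<le> a i" and lim: "a \<longlonglongrightarrow> 0"
  shows "summable (\<lambda>i. \<psi> i * of_real (a i))"
  unfolding summable_Cauchy
proof (intro allI impI)
  fix e :: real assume "e > 0"
  have nonneg: "0 \<le> a i" if "i \<ge> m" for i
  proof (rule decseq_ge[of "\<lambda>n. a (n + m)" 0 "i - m", simplified, unfolded le_add_diff_inverse2[OF that]])
    show "decseq (\<lambda>n. a (n + m))" using anti by (intro decseq_SucI) simp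
    show "(\<lambda>n. a (n + m)) \<longlonglongrightarrow> 0" using lim by (rule LIMSEQ_ignore_initial_segment)
  qed
  have "(\<lambda>n. 2 * B * a n) \<longlonglongrightarrow> 0" using tendsto_mult_right_zero[OF lim] by simp
  then have "\<forall>\<^sub>F n in sequentially. 2 * B * a n < e" using \<open>e > 0\<close> by (rule order_tendstoD)
  then obtain N where N: "\<And>n. n \<ge> N \<Longrightarrow> 2 * B * a n < e" by (auto simp: eventually_sequentially)
  show "\<exists>N. \<forall>p\<ge>N. \<forall>n. norm (\<Sum>i\<in>{p..<n}. \<psi> i * of_real (a i)) < e"
  proof (intro exI allI impI)
    fix p n assume "p \<ge> max N m"
    then show "norm (\<Sum>i\<in>{p..<n}. \<psi> i * of_real (a i)) < e"
      using norm_abel_sum_le[OF B, of p a n] anti nonneg N[of p] by fastforce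
  qed
qed

text \<open>The derivative \<open>x powr (- s - 1) * (1 - s * ln x)\<close> is nonpositive for
  \<open>x \<ge> exp 1\<close>, and 3 is the first integer beyond that point.\<close>

lemma ln_powr_antimono:
  assumes s: "s \<ge> 1" and i: "i \<ge> (3::nat)"
  shows "ln (real (Suc i)) * real (Suc i) powr (- s) \<le> ln (real i) * real i powr (- s)"
proof (rule DERIV_nonpos_imp_nonincreasing[of "real i" "real (Suc i)" "\<lambda>x. ln x * x powr (- s)"])
  fix x assume x: "real i \<le> x" "x \<le> real (Suc i)"
  have "exp 1 \<le> x" using i exp_le x(1) by linarith
  then have x0: "x > 0" using less_le_trans[OF exp_gt_zero] by blast
  then have "ln x \<ge> 1" using \<open>exp 1 \<le> x\<close> by (simp add: ln_ge_iff)
  then have "s * ln x \<ge> 1" using s mult_mono[of 1 s 1 "ln x"] by simp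
  then have "x powr (- s - 1) * (1 - s * ln x) \<le> 0" by (simp add: mult_nonneg_nonpos)
  moreover have "((\<lambda>x. ln x * x powr (- s)) has_real_derivative x powr (- s - 1) * (1 - s * ln x)) (at x)"
    using x0 by (auto intro!: derivative_eq_intros simp: powr_diff powr_minus field_simps)
  ultimately show "\<exists>y. ((\<lambda>x. ln x * x powr (- s)) has_real_derivative y) (at x) \<and> y \<le> 0" by blast
qed simp

text \<open>The weights decrease only from 3 on. Below 3 only the term at 2 can be nonzero, and its
  norm is at most 1; from 3 on Abel summation gives at most \<open>2 * B\<close>, as the first
  weight is at most 2/3. The point is that neither \<open>s\<close> nor \<open>N\<close> enters the
  bound.\<close>

lemma norm_log_partial_sum_le:
  fixes \<psi> :: "nat \<Rightarrow> complex"
  assumes le1: "\<And>n. norm (\<psi> n) \<le> 1" and B: "\<And>n. norm (\<Sum>i<n. \<psi> i) \<le> B" and s: "s \<ge> 1"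
  shows "norm (\<Sum>n<N. \<psi> n * of_real (ln (real n) * real n powr (- s))) \<le> 1 + 2 * B"
proof -
  define f where "f n = \<psi> n * of_real (ln (real n) * real n powr (- s))" for n
  have B0: "B \<ge> 0" using B[of 0] by simp
  have small: "norm (\<Sum>n<M. f n) \<le> 1" if "M \<le> 3" for M
  proof -
    have "ln 2 * 2 powr (- s) \<le> (1::real)"
      using s ln_le_minus_one[of 2] powr_mono[of "- s" 0 2] by (intro mult_le_one) auto
    moreover have "norm (f 2) \<le> \<bar>ln 2 * 2 powr (- s)\<bar>"
      using le1[of 2] by (simp add: f_def norm_mult abs_mult mult_left_le_one_le)
    ultimately have "norm (f 2) \<le> 1" by simp
    moreover have "f 0 = 0" "f (Suc 0) = 0" by (simp_all add: f_def)
    moreover have "M \<in> {0, 1, 2, 3}" using that by auto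
    ultimately show ?thesis by (auto simp: numeral_3_eq_3 numeral_2_eq_2)
  qed
  have large: "norm (\<Sum>n\<in>{3..<N}. f n) \<le> 2 * B"
  proof -
    have "norm (\<Sum>n\<in>{3..<N}. f n) \<le> 2 * B * (ln (real 3) * real 3 powr (- s))"
      unfolding f_def by (rule norm_abel_sum_le[OF B]) (use ln_powr_antimono[OF s] in auto)
    also have "ln (real 3) * real 3 powr (- s) \<le> 2 * (1 / 3)"
      using s ln_le_minus_one[of 3] powr_mono[of "- s" "- 1" 3]
      by (intro mult_mono) (auto simp: powr_minus_divide)
    finally show ?thesis using B0 by (simp add: mult_left_mono)
  qed
  show ?thesis
  proof (cases "N \<le> 3")
    case True
    then show ?thesis using small[OF True] B0 by (simp add: f_def)
  next
    case False
    then have "(\<Sum>n<N. f n) = (\<Sum>n<3. f n) + (\<Sum>n\<in>{3..<N}. f n)"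
      using sum.atLeastLessThan_concat[of 0 3 N f] by (simp add: atLeast0LessThan)
    then show ?thesis
      using small[of 3] large norm_triangle_ineq[of "\<Sum>n<3. f n" "\<Sum>n\<in>{3..<N}. f n"] by (simp add: f_def)
  qed
qed

lemma summable_bounded_char:
  fixes \<psi> :: "nat \<Rightarrow> complex"
  assumes B: "\<And>n. norm (\<Sum>i<n. \<psi> i) \<le> B" and s: "s > 0"
  shows "summable (\<lambda>n. \<psi> n * of_nat n powr (- complex_of_real s))"
  unfolding nat_powr_of_real
proof (rule summable_abel[OF B, where m = 1])
  show "real (Suc i) powr (- s) \<le> real i powr (- s)" if "i \<ge> 1" for i
    using that s by (intro powr_mono2') auto
  show "(\<lambda>n. real n powr (- s)) \<longlonglongrightarrow> 0"
    using s by (intro tendsto_neg_powr filterlim_real_sequentially) auto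
qed

text \<open>At \<open>s = 1\<close> absolute convergence may fail, so the mean value bound is
  applied to the partial sums, whose derivatives are uniformly bounded, and then carried to the
  limit.\<close>

lemma dseries_lipschitz:
  fixes \<psi> :: "nat \<Rightarrow> complex"
  assumes le1: "\<And>n. norm (\<psi> n) \<le> 1" and B: "\<And>n. norm (\<Sum>i<n. \<psi> i) \<le> B"
    and s: "s \<ge> 1" and t: "t \<ge> 1"
  shows "norm (dseries \<psi> (of_real s) - dseries \<psi> (of_real t)) \<le> (1 + 2 * B) * \<bar>s - t\<bar>"
proof -
  define P where "P N z = (\<Sum>n<N. \<psi> n * of_nat n powr (- z))" for N and z :: complex
  have part: "norm (P N (of_real s) - P N (of_real t)) \<le> (1 + 2 * B) * norm (complex_of_real s - of_real t)" for N
  proof (rule field_differentiable_bound[of "closed_segment (complex_of_real s) (of_real t)"])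
    fix z :: complex assume "z \<in> closed_segment (of_real s) (of_real t)"
    then obtain x where z: "z = of_real x" and "x \<in> closed_segment s t"
      by (auto simp: closed_segment_of_real)
    then have x: "x \<ge> 1" using s t by (auto simp: closed_segment_eq_real_ivl split: if_splits)
    show "(P N has_field_derivative (\<Sum>n<N. \<psi> n * - (of_real (ln (real n)) * of_nat n powr (- z))))
      (at z within closed_segment (of_real s) (of_real t))"
      unfolding P_def
    proof (intro DERIV_sum DERIV_cmult)
      fix n
      show "((\<lambda>w. (of_nat n :: complex) powr (- w)) has_field_derivative - (of_real (ln (real n)) * of_nat n powr (- z)))
        (at z within closed_segment (of_real s) (of_real t))"
      proof (cases "n = 0")
        case False
        have "((\<lambda>w. (of_nat n :: complex) powr (- w)) has_field_derivative (Ln (of_nat n) * of_nat n powr (- z)) * (- 1))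
          (at z within closed_segment (of_real s) (of_real t))"
          by (rule DERIV_chain2[OF has_field_derivative_powr_right])
            (use False in \<open>auto intro!: derivative_eq_intros\<close>)
        then show ?thesis using False by (simp add: Ln_of_nat)
      qed simp
    qed
    have "(\<Sum>n<N. \<psi> n * - (of_real (ln (real n)) * of_nat n powr (- z))) =
      - (\<Sum>n<N. \<psi> n * of_real (ln (real n) * real n powr (- x)))"
      unfolding z nat_powr_of_real by (simp add: sum_negf)
    then show "norm (\<Sum>n<N. \<psi> n * - (of_real (ln (real n)) * of_nat n powr (- z))) \<le> 1 + 2 * B"
      using norm_log_partial_sum_le[OF le1 B x, of N] by (simp only: norm_minus_cancel)
  qed auto
  have lim: "(\<lambda>N. P N (of_real s)) \<longlonglongrightarrow> dseries \<psi> (of_real s)" if "s \<ge> 1" for s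
    unfolding P_def dseries_def using that by (intro summable_LIMSEQ summable_bounded_char[OF B]) auto
  have "norm (complex_of_real s - of_real t) = \<bar>s - t\<bar>" by (metis norm_of_real of_real_diff)
  then show ?thesis
    using part by (intro Lim_bounded[OF tendsto_norm[OF tendsto_diff[OF lim[OF s] lim[OF t]]], of 0]) auto
qed

lemma summable_norm_dseries_ln:
  assumes "\<And>n. norm (a n) \<le> ln (real n)" "s > 1"
  shows "summable (\<lambda>n. norm (a n) * real n powr (- s))"
proof (rule summable_comparison_test[OF _ summable_ln_powr[OF assms(2)]])
  show "\<exists>N. \<forall>n\<ge>N. norm (norm (a n) * real n powr (- s)) \<le> ln (real n) * real n powr (- s)"
    using assms(1) by (auto intro!: mult_right_mono)
qed

lemma summable_norm_dseries_1:
  assumes "\<And>n. norm (a n) \<le> 1" "s > 1"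
  shows "summable (\<lambda>n. norm (a n) * real n powr (- s))"
proof (rule summable_comparison_test)
  show "\<exists>N. \<forall>n\<ge>N. norm (norm (a n) * real n powr (- s)) \<le> real n powr (- s)"
    using assms(1) by (auto intro!: mult_left_le_one_le)
qed (use assms(2) in \<open>simp add: summable_real_powr_iff\<close>)

lemma summable_dseries:
  assumes "summable (\<lambda>n. norm (a n) * real n powr (- Re z))"
  shows "summable (\<lambda>n. a n * of_nat n powr (- z))"
  by (rule summable_norm_cancel) (use assms in \<open>simp add: norm_mult norm_nat_powr\<close>)

lemma norm_mult_ln_le:
  assumes "norm (x :: complex) \<le> 1" shows "norm (x * of_real (ln (real n))) \<le> ln (real n)"
proof (cases "n = 0")
  case False
  then show ?thesis using assms mult_right_mono[OF assms, of "ln (real n)"] by (simp add: norm_mult)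
qed simp

lemma norm_dseries_ln_le:
  fixes \<psi> :: "nat \<Rightarrow> complex"
  assumes le1: "\<And>n. norm (\<psi> n) \<le> 1" and B: "\<And>n. norm (\<Sum>i<n. \<psi> i) \<le> B" and s: "s > 1"
  shows "norm (dseries (\<lambda>n. \<psi> n * of_real (ln (real n))) (of_real s)) \<le> 1 + 2 * B"
proof -
  have "summable (\<lambda>n. \<psi> n * of_real (ln (real n)) * of_nat n powr (- complex_of_real s))"
    using s le1 by (intro summable_dseries summable_norm_dseries_ln norm_mult_ln_le) auto
  then have "(\<lambda>N. \<Sum>n<N. \<psi> n * of_real (ln (real n)) * of_nat n powr (- complex_of_real s)) \<longlonglongrightarrow>
      dseries (\<lambda>n. \<psi> n * of_real (ln (real n))) (of_real s)"
    unfolding dseries_def by (rule summable_LIMSEQ)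
  moreover have "norm (\<Sum>n<N. \<psi> n * of_real (ln (real n)) * of_nat n powr (- complex_of_real s)) \<le> 1 + 2 * B" for N
    using norm_log_partial_sum_le[OF le1 B, of s N] s by (simp add: nat_powr_of_real mult.assoc)
  ultimately show ?thesis
    by (intro Lim_bounded[OF tendsto_norm, of _ _ 0]) auto
qed

text \<open>Integral comparison by telescoping: the mean value theorem bounds each term from 2 on by
  a difference of values of \<open>x powr (1 - s) / (s - 1)\<close>. The term at 1 adds 1, and
  \<open>1 + 1 / (s - 1) = s / (s - 1)\<close>.\<close>

lemma zeta_le:
  assumes s: "s > 1" shows "(\<Sum>n. real n powr (- s)) \<le> s / (s - 1)"
proof (rule suminf_le_const)
  show "summable (\<lambda>n. real n powr (- s))" using s by (simp add: summable_real_powr_iff)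
  have step: "real (Suc n) powr (- s) \<le> (real n powr (1 - s) - real (Suc n) powr (1 - s)) / (s - 1)" if "n \<ge> 1" for n
  proof -
    have "\<exists>x>real n. x < real (Suc n) \<and> real (Suc n) powr (1 - s) - real n powr (1 - s) = (real (Suc n) - real n) * ((1 - s) * x powr (- s))"
    proof (rule MVT2)
      fix x assume "real n \<le> x" "x \<le> real (Suc n)"
      then have "x > 0" using that by simp
      then show "((\<lambda>x. x powr (1 - s)) has_real_derivative (1 - s) * x powr (- s)) (at x)"
        using has_real_derivative_powr[of x "1 - s"] by simp
    qed simp
    then obtain x where x: "x > real n" "x < real (Suc n)"
      "real (Suc n) powr (1 - s) - real n powr (1 - s) = (1 - s) * x powr (- s)" by auto
    then have "(real n powr (1 - s) - real (Suc n) powr (1 - s)) / (s - 1) = x powr (- s)"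
      using s by (simp add: field_simps)
    moreover have "real (Suc n) powr (- s) \<le> x powr (- s)" using x s by (intro powr_mono2') auto
    ultimately show ?thesis by simp
  qed
  \<comment> \<open>The term at 0 vanishes, so the sum runs in effect from 1 to
    \<open>N + 1\<close>, and the base case is the single term 1.\<close>
  have part: "(\<Sum>n<Suc (Suc N). real n powr (- s)) \<le> 1 + (1 - real (Suc N) powr (1 - s)) / (s - 1)" for N
  proof (induction N)
    case (Suc N)
    have "(\<Sum>n<Suc (Suc (Suc N)). real n powr (- s)) = (\<Sum>n<Suc (Suc N). real n powr (- s)) + real (Suc (Suc N)) powr (- s)"
      by simp
    also have "\<dots> \<le> 1 + (1 - real (Suc N) powr (1 - s)) / (s - 1) +
       (real (Suc N) powr (1 - s) - real (Suc (Suc N)) powr (1 - s)) / (s - 1)"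
      by (intro add_mono Suc.IH step) auto
    also have "\<dots> = 1 + (1 - real (Suc (Suc N)) powr (1 - s)) / (s - 1)" by (simp add: diff_divide_distrib)
    finally show ?case .
  qed simp
  have bd: "(\<Sum>n<Suc (Suc N). real n powr (- s)) \<le> s / (s - 1)" for N
  proof -
    have "(1 - real (Suc N) powr (1 - s)) / (s - 1) \<le> 1 / (s - 1)"
      using s by (intro divide_right_mono) auto
    moreover have "1 + 1 / (s - 1) = s / (s - 1)" using s by (simp add: field_simps)
    ultimately show ?thesis using part[of N] by linarith
  qed
  show "(\<Sum>n<N. real n powr (- s)) \<le> s / (s - 1)" for N
  proof -
    have "(\<Sum>n<N. real n powr (- s)) \<le> (\<Sum>n<Suc (Suc N). real n powr (- s))" by (intro sum_mono2) auto
    then show ?thesis using bd[of N] by linarith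
  qed
qed

lemma norm_dseries_le_zeta:
  assumes "\<And>n. norm (a n) \<le> 1" "s > 1"
  shows "norm (dseries a (of_real s)) \<le> s / (s - 1)"
proof -
  have *: "summable (\<lambda>n. norm (a n) * real n powr (- s))" by (rule summable_norm_dseries_1[OF assms])
  have "norm (dseries a (of_real s)) \<le> (\<Sum>n. norm (a n) * real n powr (- s))"
    unfolding dseries_def using summable_norm[of "\<lambda>n. a n * of_nat n powr (- complex_of_real s)"] *
    by (simp add: norm_mult norm_nat_powr)
  also have "\<dots> \<le> (\<Sum>n. real n powr (- s))"
    using assms * by (intro suminf_le mult_left_le_one_le) (auto simp: summable_real_powr_iff)
  also have "\<dots> \<le> s / (s - 1)" by (rule zeta_le[OF assms(2)])
  finally show ?thesis .
qed

text \<open>The terms beyond the first have total norm at most 3/2 - 1 = 1/2, too little to cancel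
  it. Hence 3 serves as a base point where no L-series vanishes.\<close>

lemma dseries_3_nonzero:
  assumes a: "\<And>n. norm (a n) \<le> 1" and a1: "a 1 = 1"
  shows "dseries a 3 \<noteq> 0"
proof
  assume 0: "dseries a 3 = 0"
  define b where "b n = (if n = 1 then 0 else a n)" for n
  have b: "norm (b n) \<le> 1" for n using a by (simp add: b_def)
  have "summable (\<lambda>n. norm (b n) * real n powr (- 3))" by (rule summable_norm_dseries_1[OF b]) simp
  note sb = summable_dseries[of b 3, simplified, OF this]
  have "dseries a 3 = (\<Sum>n. b n * of_nat n powr (- 3) + (if n = 1 then 1 else 0))"
    unfolding dseries_def using a1 by (intro suminf_cong) (auto simp: b_def)
  also have "\<dots> = dseries b 3 + 1"
    unfolding dseries_def using sb sums_If_finite[of "\<lambda>n. n = 1" "\<lambda>n. 1 :: complex"]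
    by (subst suminf_add[symmetric]) (auto simp: sums_iff)
  finally have "norm (dseries b 3) = 1" using 0 by (simp add: add_eq_0_iff2)
  have sn: "summable (\<lambda>n. norm (b n) * real n powr (- 3))" by (rule summable_norm_dseries_1[OF b]) simp
  have "norm (dseries b 3) \<le> (\<Sum>n. norm (b n) * real n powr (- 3))"
    unfolding dseries_def using summable_norm[of "\<lambda>n. b n * of_nat n powr (- 3)"] sn
    by (simp add: norm_mult norm_nat_powr)
  also have "\<dots> \<le> (\<Sum>n. real n powr (- 3) - (if n = 1 then 1 else 0))"
    using sn b sums_If_finite[of "\<lambda>n. n = 1" "\<lambda>n. 1 :: real"]
    by (intro suminf_le summable_diff) (auto simp: b_def sums_iff summable_real_powr_iff intro!: mult_left_le_one_le a)
  also have "\<dots> = (\<Sum>n. real n powr (- 3)) - 1"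
    using sums_If_finite[of "\<lambda>n. n = 1" "\<lambda>n. 1 :: real"]
    by (subst suminf_diff[symmetric]) (auto simp: sums_iff summable_real_powr_iff)
  also have "\<dots> \<le> 1 / 2" using zeta_le[of 3] by simp
  finally show False using \<open>norm (dseries b 3) = 1\<close> by simp
qed

section \<open>Nonvanishing for real characters\<close>

lemma sum_divisors_mult_coprime:
  fixes f :: "nat \<Rightarrow> real"
  assumes mult: "\<And>a b. f (a * b) = f a * f b" and cop: "coprime a b"
  shows "(\<Sum>d | d dvd a * b. f d) = (\<Sum>d | d dvd a. f d) * (\<Sum>d | d dvd b. f d)"
proof -
  have "bij_betw (\<lambda>(d, e). d * e) ({d. d dvd a} \<times> {e. e dvd b}) {d. d dvd a * b}"
  proof (rule bij_betwI')
    fix x y assume "x \<in> {d. d dvd a} \<times> {e. e dvd b}" "y \<in> {d. d dvd a} \<times> {e. e dvd b}"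
    then obtain d e d' e' where xy: "x = (d, e)" "y = (d', e')" "d dvd a" "d' dvd a" "e dvd b" "e' dvd b"
      by auto
    then have "coprime d e'" "coprime d' e" using cop coprime_divisors by blast+
    then show "(case x of (d, e) \<Rightarrow> d * e) = (case y of (d, e) \<Rightarrow> d * e) \<longleftrightarrow> x = y"
      using coprime_crossproduct_nat[of d e' d' e] xy by auto
  next
    fix n assume "n \<in> {d. d dvd a * b}"
    then obtain d e where "n = d * e" "d dvd a" "e dvd b" using dvd_productE by (metis mem_Collect_eq)
    then show "\<exists>x\<in>{d. d dvd a} \<times> {e. e dvd b}. n = (case x of (d, e) \<Rightarrow> d * e)" by auto
  qed (auto intro: mult_dvd_mono)
  then have "(\<Sum>d | d dvd a * b. f d) = (\<Sum>x\<in>{d. d dvd a} \<times> {e. e dvd b}. f (case x of (d, e) \<Rightarrow> d * e))"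
    by (rule sum.reindex_bij_betw[symmetric])
  also have "\<dots> = (\<Sum>d | d dvd a. \<Sum>e | e dvd b. f d * f e)"
    by (subst sum.cartesian_product) (auto intro!: sum.cong simp: mult)
  finally show ?thesis by (simp add: sum_product)
qed

lemma sum_divisors_prime_power:
  fixes f :: "nat \<Rightarrow> real"
  assumes p: "prime p" and one: "f 1 = 1" and mult: "\<And>a b. f (a * b) = f a * f b"
  shows "(\<Sum>d | d dvd p ^ n. f d) = (\<Sum>i\<le>n. f p ^ i)"
proof -
  have "f (p ^ i) = f p ^ i" for i using one by (induction i) (simp_all add: mult)
  moreover have "{d. d dvd p ^ n} = (\<lambda>i. p ^ i) ` {..n}"
    using divides_primepow_nat[OF p] by auto
  moreover have "inj_on (\<lambda>i. p ^ i) {..n}"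
    using prime_gt_1_nat[OF p] by (auto simp: inj_on_def)
  ultimately show ?thesis by (simp add: sum.reindex)
qed

lemma geometric_sign_sum:
  fixes x :: real
  assumes "x \<in> {- 1, 0, 1}"
  shows "(\<Sum>i\<le>n. x ^ i) \<ge> 0" "(\<Sum>i\<le>2 * n. x ^ i) \<ge> 1"
proof -
  consider "x = - 1" | "x = 0" | "x = 1" using assms by auto
  then have "(\<Sum>i\<le>n. x ^ i) \<ge> 0 \<and> (\<Sum>i\<le>2 * n. x ^ i) \<ge> 1"
  proof cases
    case 1
    have "(\<Sum>i\<le>m. (- 1 :: real) ^ i) = (if even m then 1 else 0)" for m by (induction m) auto
    then show ?thesis using 1 by simp
  qed (auto simp: power_0_left)
  then show "(\<Sum>i\<le>n. x ^ i) \<ge> 0" "(\<Sum>i\<le>2 * n. x ^ i) \<ge> 1" by auto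
qed

text \<open>Both divisor sums are multiplicative, so splitting off a prime power leaves sums of
  powers of \<open>f p\<close>. For a square the exponent is even; even \<open>f p = - 1\<close>
  then gives an odd number of alternating terms, with sum 1.\<close>

lemma real_char_divisor_sum:
  fixes f :: "nat \<Rightarrow> real"
  assumes one: "f 1 = 1" and mult: "\<And>a b. f (a * b) = f a * f b" and val: "\<And>a. f a \<in> {- 1, 0, 1}"
    and n: "n > 0"
  shows "(\<Sum>d | d dvd n. f d) \<ge> 0 \<and> (\<Sum>d | d dvd n ^ 2. f d) \<ge> 1"
  using n
proof (induction n rule: less_induct)
  case (less n)
  show ?case
  proof (cases "n = 1")
    case True
    then show ?thesis using one by simp
  next
    case False
    then obtain p where p: "prime p" "p dvd n" using prime_factor_nat by blast
    obtain y where y: "n = p ^ multiplicity p n * y" "\<not> p dvd y"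
      using multiplicity_decompose'[of n p] p(1) less.prems by (metis not_prime_unit not_gr_zero)
    define a where "a = multiplicity p n"
    have "a > 0" using p less.prems by (simp add: a_def prime_multiplicity_gt_zero_iff)
    have "y > 0" using y less.prems by (cases y) auto
    have "p ^ a > 1" using \<open>a > 0\<close> prime_gt_1_nat[OF p(1)] one_less_power by blast
    then have "y < n" using y(1) \<open>y > 0\<close> unfolding a_def[symmetric] by simp
    note IH = less.IH[OF this \<open>y > 0\<close>]
    have cop: "coprime (p ^ a) y" using p(1) y(2) by (simp add: prime_imp_coprime)
    have eq: "n = p ^ a * y" using y(1) by (simp add: a_def)
    have "n ^ 2 = p ^ (2 * a) * y ^ 2" by (simp add: eq power_mult_distrib power_mult mult.commute[of 2])
    moreover have "coprime (p ^ (2 * a)) (y ^ 2)" using p(1) y(2) by (simp add: prime_imp_coprime)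
    ultimately have "(\<Sum>d | d dvd n ^ 2. f d) = (\<Sum>i\<le>2 * a. f p ^ i) * (\<Sum>d | d dvd y ^ 2. f d)"
      using sum_divisors_mult_coprime[OF mult] sum_divisors_prime_power[of p f, OF p(1) one mult] by simp
    moreover have "(\<Sum>d | d dvd n. f d) = (\<Sum>i\<le>a. f p ^ i) * (\<Sum>d | d dvd y. f d)"
      unfolding eq using sum_divisors_mult_coprime[OF mult cop] sum_divisors_prime_power[of p f, OF p(1) one mult] by simp
    ultimately show ?thesis
      using IH geometric_sign_sum[OF val[of p], of a] mult_mono[of 1 "\<Sum>i\<le>2 * a. f p ^ i" 1 "\<Sum>d | d dvd y ^ 2. f d"]
      by simp
  qed
qed

section \<open>Comparison weights for the Lambert series\<close>

lemma sum_powers_ge: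
  fixes u :: real
  assumes "u \<ge> 0" shows "(\<Sum>i<Suc n. (u ^ 2) ^ i) \<ge> real (Suc n) * u ^ n"
proof -
  have "2 * (real (Suc n) * u ^ n) = (\<Sum>i<Suc n. 2 * u ^ n)" by simp
  \<comment> \<open>Arithmetic-geometric mean for the terms with indices \<open>i\<close> and
    \<open>n - i\<close>.\<close>
  also have "\<dots> \<le> (\<Sum>i<Suc n. (u ^ 2) ^ i + (u ^ 2) ^ (n - i))"
  proof (rule sum_mono)
    fix i assume "i \<in> {..<Suc n}"
    then have "u ^ i * u ^ (n - i) = u ^ n" by (simp flip: power_add)
    moreover have "0 \<le> (u ^ i - u ^ (n - i))\<^sup>2" by simp
    ultimately show "2 * u ^ n \<le> (u ^ 2) ^ i + (u ^ 2) ^ (n - i)"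
      by (simp add: power2_diff flip: power_mult mult.commute[of 2])
  qed
  also have "\<dots> = (\<Sum>i<Suc n. (u ^ 2) ^ i) + (\<Sum>i<Suc n. (u ^ 2) ^ (n - i))" by (rule sum.distrib)
  also have "(\<Sum>i<Suc n. (u ^ 2) ^ (n - i)) = (\<Sum>i<Suc n. (u ^ 2) ^ i)"
    using sum.nat_diff_reindex[of "\<lambda>i. (u ^ 2) ^ i" "Suc n"] by simp
  finally show ?thesis by simp
qed

text \<open>The error in replacing a Lambert weight by \<open>1 / (n * (1 - t))\<close>; summed
  against a character, the latter gives L(1) / (1 - t). At \<open>n = 0\<close> both quotients have
  denominator 0, so the value is 0.\<close>

definition lambert_gap :: "real \<Rightarrow> nat \<Rightarrow> real" where
  "lambert_gap t n = 1 / (real n * (1 - t)) - t ^ n / (1 - t ^ n)"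

text \<open>With \<open>Q n\<close> the sum of \<open>t ^ i\<close> for \<open>i < n\<close>, the
  difference times \<open>1 - t\<close> is
  \<open>1 / (n * (n + 1)) - t ^ n / (Q n * Q (n + 1))\<close>. In terms of
  \<open>u = sqrt t\<close>, \<open>sum_powers_ge\<close> yields
  \<open>Q n * Q (n + 1) \<ge> n * (n + 1) * u ^ (2 * n - 1)\<close>, and
  \<open>u ^ (2 * n - 1) \<ge> t ^ n\<close>.\<close>

lemma lambert_gap_antimono:
  assumes "0 < t" "t < 1" "n \<ge> 1"
  shows "lambert_gap t (Suc n) \<le> lambert_gap t n"
proof -
  define u where "u = sqrt t"
  have u: "0 < u" "u < 1" "t = u ^ 2" using assms by (simp_all add: u_def)
  define Q where "Q n = (\<Sum>i<n. t ^ i)" for n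
  have geo: "1 - t ^ n = (1 - t) * Q n" for n
    unfolding Q_def by (metis one_diff_power_eq)
  have Q1: "Q n \<ge> real n * u ^ (n - 1)" "Q (Suc n) \<ge> real (Suc n) * u ^ n"
    using sum_powers_ge[of u "n - 1"] sum_powers_ge[of u n] u assms(3) by (simp_all add: Q_def del: sum.lessThan_Suc)
  have Qpos: "Q n > 0" "Q (Suc n) > 0"
    using less_le_trans[OF _ Q1(1)] less_le_trans[OF _ Q1(2)] u assms(3) by simp_all
  have "t ^ n * (real n * real (Suc n)) \<le> u ^ (n - 1) * u ^ n * (real n * real (Suc n))"
  proof (rule mult_right_mono)
    have "t ^ n = u ^ (n + n)" by (simp add: u(3) flip: power_mult) (simp add: mult_2)
    also have "\<dots> \<le> u ^ (n - 1 + n)" using u by (intro power_decreasing) auto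
    finally show "t ^ n \<le> u ^ (n - 1) * u ^ n" by (simp add: power_add)
  qed simp
  also have "\<dots> = (real n * u ^ (n - 1)) * (real (Suc n) * u ^ n)" by simp
  also have "\<dots> \<le> Q n * Q (Suc n)"
    using Q1 Qpos u by (intro mult_mono) auto
  finally have key: "t ^ n / (Q n * Q (Suc n)) \<le> 1 / (real n * real (Suc n))"
    using Qpos assms(3) by (simp add: divide_simps del: of_nat_Suc)
  have QS: "Q (Suc n) = 1 + t * Q n"
    unfolding Q_def by (simp add: sum.lessThan_Suc_shift sum_distrib_left del: sum.lessThan_Suc)
  have gap: "(1 - t) * lambert_gap t m = 1 / real m - t ^ m / Q m" for m
  proof -
    have "d * (1 / (x * d) - y / (d * q)) = 1 / x - y / q" if "d \<noteq> 0" for d x y q :: real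
      using that by (simp add: right_diff_distrib)
    then show ?thesis unfolding lambert_gap_def geo using assms by simp
  qed
  have "(1 - t) * (lambert_gap t n - lambert_gap t (Suc n)) =
    (1 / real n - 1 / real (Suc n)) - (t ^ n / Q n - t ^ Suc n / Q (Suc n))"
    by (simp only: right_diff_distrib gap)
  also have "1 / real n - 1 / real (Suc n) = 1 / (real n * real (Suc n))"
    using assms(3) by (simp add: field_simps)
  also have "t ^ n / Q n - t ^ Suc n / Q (Suc n) = t ^ n * (Q (Suc n) - t * Q n) / (Q n * Q (Suc n))"
    using Qpos by (simp add: field_simps)
  also have "Q (Suc n) - t * Q n = 1" using QS by simp
  finally have "(1 - t) * (lambert_gap t n - lambert_gap t (Suc n)) \<ge> 0" using key by simp
  then show ?thesis using assms by (simp add: zero_le_mult_iff)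
qed

lemma lambert_gap_tendsto_0:
  assumes "0 < t" "t < 1" shows "lambert_gap t \<longlonglongrightarrow> 0"
proof -
  have "(\<lambda>n. (1 / (1 - t)) * inverse (real n) - t ^ n / (1 - t ^ n)) \<longlonglongrightarrow> (1 / (1 - t)) * 0 - 0 / (1 - 0)"
    using assms by (intro tendsto_intros lim_inverse_n LIMSEQ_power_zero) auto
  then show ?thesis by (simp add: lambert_gap_def[abs_def] field_simps)
qed

text \<open>Monsky's argument: if the series \<open>\<Sum> \<psi>(n) / n\<close> vanished, the Lambert series
  \<open>\<Sum> \<psi>(n) t^n / (1 - t^n)\<close> would stay bounded as \<open>t\<close> tends to \<open>1\<close>, although its power series
  coefficients are nonnegative and at least \<open>1\<close> at the squares.\<close>

lemma real_char_dseries_1_nonzero: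
  assumes k: "k > 0" and \<psi>: "\<psi> \<in> dirichlet_chars k" "\<psi> \<noteq> principal_char k" and real: "\<And>n. cnj (\<psi> n) = \<psi> n"
  shows "dseries \<psi> 1 \<noteq> 0"
proof
  assume zero: "dseries \<psi> 1 = 0"
  note B = norm_sum_char_le[OF k \<psi>]
  define f where "f n = Re (\<psi> n)" for n
  have \<psi>f: "\<psi> n = of_real (f n)" for n using real[of n] by (simp add: f_def complex_eq_iff)
  have f_one: "f 1 = 1" using char_one[OF k \<psi>(1)] by (simp add: f_def)
  have f_mult: "f (a * b) = f a * f b" for a b
    using char_mult[OF k \<psi>(1), of a b] unfolding \<psi>f by (simp flip: of_real_mult)
  have f_val: "f a \<in> {- 1, 0, 1}" for a
    using norm_char[OF k \<psi>(1), of a] char_eq_0_iff[OF k \<psi>(1), of a] unfolding \<psi>f by (cases "coprime a k") auto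
  define c where "c n = (\<Sum>d | d dvd n. f d)" for n
  have c: "c n \<ge> 0" "c (n ^ 2) \<ge> 1" if "n > 0" for n
    using real_char_divisor_sum[of f, OF f_one f_mult f_val that] by (simp_all add: c_def)
  \<comment> \<open>Geometric expansion gives a double series over pairs \<open>(n, j)\<close>,
    absolutely summable for \<open>t < 1\<close>; grouping by the product \<open>n * j\<close>
    produces the divisor sums \<open>c\<close>.\<close>
  have lambert: "((\<lambda>n. of_real (c n * t ^ n)) has_sum (\<Sum>n. \<psi> n * of_real (t ^ n / (1 - t ^ n)))) {0<..}"
    if t: "0 < t" "t < 1" for t :: real
  proof -
    define g where "g = (\<lambda>(n, j). \<psi> n * of_real (t ^ (n * j)) :: complex)"
    have tn: "t ^ n < 1" "norm (t ^ n) < 1" if "n > 0" for n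
      using t that by (simp_all add: power_less_one_iff abs_less_iff)
    have geom: "((\<lambda>j. t ^ (n * j)) has_sum (t ^ n / (1 - t ^ n))) {0<..}" if "n > 0" for n
      using has_sum_geometric_from_1[OF tn(2)[OF that]] by (simp add: power_mult Suc_le_eq greaterThan_def atLeast_def)
    have term_le: "norm (\<psi> n * of_real (t ^ n / (1 - t ^ n))) \<le> t ^ n / (1 - t)" for n
    proof (cases "n = 0")
      case False
      have "t ^ n \<le> t" using t False power_decreasing[of 1 n t] by simp
      then have "t ^ n / (1 - t ^ n) \<le> t ^ n / (1 - t)" using t tn False by (intro divide_left_mono) auto
      moreover have "norm (\<psi> n * of_real (t ^ n / (1 - t ^ n))) \<le> 1 * (t ^ n / (1 - t ^ n))"
        unfolding norm_mult norm_of_real using tn[of n] t False norm_char_le_1[OF k \<psi>(1), of n]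
        by (intro mult_mono) auto
      ultimately show ?thesis by linarith
    qed (use t in simp)
    have geo_summable: "summable (\<lambda>n. t ^ n / (1 - t))"
      using t by (intro summable_divide summable_geometric) auto
    have sn: "summable (\<lambda>n. norm (\<psi> n * of_real (t ^ n / (1 - t ^ n))))"
      by (rule summable_comparison_test[OF _ geo_summable]) (use term_le in auto)
    have outer: "((\<lambda>n. \<psi> n * of_real (t ^ n / (1 - t ^ n))) has_sum (\<Sum>n. \<psi> n * of_real (t ^ n / (1 - t ^ n)))) {0<..}"
      using norm_summable_imp_has_sum[OF sn summable_sums[OF summable_norm_cancel[OF sn]]]
      by (subst has_sum_positive_iff) simp_all
    have inner_norm: "((\<lambda>j. norm (g (n, j))) has_sum norm (\<psi> n * of_real (t ^ n / (1 - t ^ n)))) {0<..}" if "n > 0" for n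
    proof -
      have "((\<lambda>j. norm (\<psi> n) * t ^ (n * j)) has_sum (norm (\<psi> n) * (t ^ n / (1 - t ^ n)))) {0<..}"
        by (intro has_sum_cmult_right geom that)
      moreover have "norm (\<psi> n * of_real (t ^ n / (1 - t ^ n))) = norm (\<psi> n) * (t ^ n / (1 - t ^ n))"
        unfolding norm_mult norm_of_real using tn[OF that] t by simp
      ultimately show ?thesis using t by (simp add: g_def norm_mult norm_power)
    qed
    have "(\<lambda>p. norm (g p)) summable_on ({0<..} \<times> {0<..})"
    proof (subst Infinite_Sum.abs_summable_on_Sigma_iff, intro conjI ballI)
      fix n :: nat assume "n \<in> {0<..}"
      then show "(\<lambda>j. norm (g (n, j))) summable_on {0<..}" using has_sum_imp_summable[OF inner_norm] by simp
    next
      have "summable (\<lambda>n. norm (norm (\<psi> n * of_real (t ^ n / (1 - t ^ n)))))" using sn by (simp only: real_norm_def abs_norm_cancel)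
      then have "(\<lambda>n. norm (\<psi> n * of_real (t ^ n / (1 - t ^ n)))) summable_on UNIV"
        by (rule norm_summable_imp_summable_on)
      then have "(\<lambda>n. norm (\<psi> n * of_real (t ^ n / (1 - t ^ n)))) summable_on {0<..}"
        by (rule summable_on_subset_banach) (rule subset_UNIV)
      also have "?this \<longleftrightarrow> (\<lambda>n. norm (\<Sum>\<^sub>\<infinity>j\<in>{0<..}. norm (g (n, j)))) summable_on {0<..}"
      proof (rule summable_on_cong)
        fix n :: nat assume "n \<in> {0<..}"
        then have "(\<Sum>\<^sub>\<infinity>j\<in>{0<..}. norm (g (n, j))) = norm (\<psi> n * of_real (t ^ n / (1 - t ^ n)))"
          by (intro infsumI inner_norm) simp
        then show "norm (\<psi> n * of_real (t ^ n / (1 - t ^ n))) = norm (\<Sum>\<^sub>\<infinity>j\<in>{0<..}. norm (g (n, j)))"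
          by (simp only: real_norm_def abs_norm_cancel)
      qed
      finally show "(\<lambda>n. norm (\<Sum>\<^sub>\<infinity>j\<in>{0<..}. norm (g (n, j)))) summable_on {0<..}" .
    qed
    then have "g summable_on ({0<..} \<times> {0<..})" by (rule Infinite_Sum.abs_summable_summable)
    then have "(g has_sum (\<Sum>n. \<psi> n * of_real (t ^ n / (1 - t ^ n)))) ({0<..} \<times> {0<..})"
    proof (rule has_sum_SigmaI[rotated 2])
      show "((\<lambda>j. g (n, j)) has_sum (\<psi> n * of_real (t ^ n / (1 - t ^ n)))) {0<..}" if "n \<in> {0<..}" for n
        using has_sum_cmult_right[OF has_sum_of_real[OF geom[of n]], of "\<psi> n"] that by (simp add: g_def)
    qed (rule outer)
    from has_sum_divisors[OF this] show ?thesis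
    proof (rule has_sum_cong[THEN iffD1, rotated])
      fix n :: nat assume "n \<in> {0<..}"
      have "(\<Sum>d | d dvd n. g (d, n div d)) = (\<Sum>d | d dvd n. of_real (f d * t ^ n))"
        by (intro sum.cong) (auto simp: g_def \<psi>f)
      then show "(\<Sum>d | d dvd n. g (d, n div d)) = of_real (c n * t ^ n)"
        by (simp add: c_def sum_distrib_right)
    qed
  qed
  \<comment> \<open>Because L(1) = 0, its multiple by \<open>1 / (1 - t)\<close> can be subtracted
    freely. The decreasing weights \<open>lambert_gap t\<close> remain; the one at 1 equals 1, so
    Abel summation gives a bound free of \<open>t\<close>.\<close>
  have upper: "norm (\<Sum>n. \<psi> n * of_real (t ^ n / (1 - t ^ n))) \<le> 2 * real k" if t: "0 < t" "t < 1" for t :: real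
  proof -
    have s1: "summable (\<lambda>n. \<psi> n * of_nat n powr (- complex_of_real 1))"
      by (rule summable_bounded_char[OF B]) simp
    have s2: "summable (\<lambda>n. \<psi> n * of_real (lambert_gap t n))"
      by (rule summable_abel[OF B lambert_gap_antimono[OF t] lambert_gap_tendsto_0[OF t]])
    have eq: "\<psi> n * of_real (t ^ n / (1 - t ^ n)) =
       (1 / of_real (1 - t)) * (\<psi> n * of_nat n powr (- complex_of_real 1)) - \<psi> n * of_real (lambert_gap t n)" for n
      unfolding nat_powr_of_real by (simp add: lambert_gap_def powr_minus_divide algebra_simps)
    have d1: "dseries \<psi> 1 = (\<Sum>n. \<psi> n * of_nat n powr (- complex_of_real 1))"
      by (simp add: dseries_def)
    have "(\<Sum>n. \<psi> n * of_real (t ^ n / (1 - t ^ n))) =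
       (1 / of_real (1 - t)) * dseries \<psi> 1 - (\<Sum>n. \<psi> n * of_real (lambert_gap t n))"
      unfolding eq d1
      by (simp only: suminf_diff[OF summable_mult[OF s1] s2, symmetric] suminf_mult[OF s1, symmetric])
    then have "norm (\<Sum>n. \<psi> n * of_real (t ^ n / (1 - t ^ n))) = norm (\<Sum>n. \<psi> n * of_real (lambert_gap t n))"
      by (simp add: zero)
    also have "\<dots> \<le> 2 * real k"
    proof (rule Lim_bounded[OF tendsto_norm[OF summable_LIMSEQ[OF s2]], of 1], intro allI impI)
      fix N :: nat assume "N \<ge> 1"
      have nonneg: "lambert_gap t i \<ge> 0" if "i \<ge> 1" for i
      proof -
        have "decseq (\<lambda>n. lambert_gap t (n + 1))" using lambert_gap_antimono[OF t] by (intro decseq_SucI) simp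
        from decseq_ge[OF this LIMSEQ_ignore_initial_segment[OF lambert_gap_tendsto_0[OF t]], of "i - 1"]
        show ?thesis using that by simp
      qed
      have "(\<Sum>n<N. \<psi> n * of_real (lambert_gap t n)) = (\<Sum>n\<in>{1..<N}. \<psi> n * of_real (lambert_gap t n))"
        by (rule sum.mono_neutral_right) (auto simp: lambert_gap_def not_less_eq_eq)
      also have "norm \<dots> \<le> 2 * real k * lambert_gap t 1"
        by (rule norm_abel_sum_le[OF B, where a = "lambert_gap t"]) (use lambert_gap_antimono[OF t] nonneg in auto)
      also have "lambert_gap t 1 = 1" using t by (simp add: lambert_gap_def flip: diff_divide_distrib)
      finally show "norm (\<Sum>n<N. \<psi> n * of_real (lambert_gap t n)) \<le> 2 * real k" by simp
    qed
    finally show ?thesis .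
  qed
  \<comment> \<open>The squares of 1, ..., \<open>M\<close> alone contribute at least
    \<open>M * t ^ (M ^ 2)\<close>, and \<open>t\<close> tends to 1.\<close>
  have "real M \<le> 2 * real k" for M :: nat
  proof (rule tendsto_upperbound)
    have "((\<lambda>t. real M * t ^ (M ^ 2)) \<longlongrightarrow> real M * 1 ^ (M ^ 2)) (at_left 1)"
      by (intro tendsto_intros)
    then show "((\<lambda>t. real M * t ^ (M ^ 2)) \<longlongrightarrow> real M) (at_left 1)" by simp
    have "real M * t ^ (M ^ 2) \<le> 2 * real k" if t: "0 < t" "t < 1" for t
    proof -
      let ?A = "(\<lambda>n. n ^ 2) ` {1..M}"
      have "real M * t ^ (M ^ 2) = (\<Sum>n\<in>{1..M}. t ^ (M ^ 2))" by simp
      also have "\<dots> \<le> (\<Sum>n\<in>{1..M}. c (n ^ 2) * t ^ (n ^ 2))"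
      proof (rule sum_mono)
        fix n assume n: "n \<in> {1..M}"
        have "1 * t ^ (M ^ 2) \<le> c (n ^ 2) * t ^ (n ^ 2)"
          using n c[of n] t by (intro mult_mono power_decreasing power_mono) auto
        then show "t ^ (M ^ 2) \<le> c (n ^ 2) * t ^ (n ^ 2)" by simp
      qed
      also have "\<dots> = (\<Sum>n\<in>?A. c n * t ^ n)"
        by (subst sum.reindex) (auto simp: inj_on_def)
      also have "\<dots> \<le> Re (\<Sum>n. \<psi> n * of_real (t ^ n / (1 - t ^ n)))"
        using has_sum_Re[OF lambert[OF t]] c(1) t
        by (intro finite_sum_le_has_sum[where A = "{0<..}"]) auto
      also have "\<dots> \<le> 2 * real k" using upper[OF t] complex_Re_le_cmod order_trans by blast
      finally show ?thesis .
    qed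
    then show "\<forall>\<^sub>F t in at_left 1. real M * t ^ (M ^ 2) \<le> 2 * real k"
      using eventually_at_left_real[of 0 1] by (auto elim!: eventually_mono)
  qed simp
  from this[of "2 * k + 1"] show False by simp
qed

section \<open>Primes in arithmetic progressions\<close>

lemma norm_mangoldt_mult_le:
  assumes "norm (x :: complex) \<le> 1" shows "norm (x * mangoldt n) \<le> ln (real n)"
proof (cases "n = 0")
  case False
  have "norm (x * mangoldt n) \<le> 1 * mangoldt n"
    unfolding norm_mult norm_mangoldt using assms mangoldt_nonneg by (intro mult_right_mono) auto
  then show ?thesis using mangoldt_le[of n] False by simp
qed simp

text \<open>Complete multiplicativity pulls \<open>\<psi> n\<close> out of the convolution, and the
  values of \<open>mangoldt\<close> at the divisors of \<open>n\<close> add up to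
  \<open>ln n\<close>. The product form avoids dividing by an L-series that might vanish.\<close>

lemma dseries_mult_mangoldt:
  assumes k: "k > 0" and \<psi>: "\<psi> \<in> dirichlet_chars k" and z: "Re z > 1"
  shows "dseries \<psi> z * dseries (\<lambda>n. \<psi> n * mangoldt n) z = dseries (\<lambda>n. \<psi> n * of_real (ln (real n))) z"
proof -
  note le1 = norm_char_le_1[OF k \<psi>]
  have "dseries (\<lambda>n. \<psi> n * mangoldt n) z * dseries \<psi> z =
      dseries (\<lambda>n. \<Sum>d | d dvd n. \<psi> d * mangoldt d * \<psi> (n div d)) z"
    using z le1 by (intro dseries_mult summable_norm_dseries_ln summable_norm_dseries_1 norm_mangoldt_mult_le) auto
  also have "\<dots> = dseries (\<lambda>n. \<psi> n * of_real (ln (real n))) z"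
    unfolding dseries_def
  proof (rule suminf_cong)
    fix n
    show "(\<Sum>d | d dvd n. \<psi> d * mangoldt d * \<psi> (n div d)) * of_nat n powr (- z) =
      \<psi> n * of_real (ln (real n)) * of_nat n powr (- z)"
    proof (cases "n = 0")
      case False
      have "(\<Sum>d | d dvd n. \<psi> d * mangoldt d * \<psi> (n div d)) = (\<Sum>d | d dvd n. \<psi> n * mangoldt d)"
      proof (intro sum.cong refl)
        fix d assume "d \<in> {d. d dvd n}"
        then have "\<psi> n = \<psi> d * \<psi> (n div d)" using char_mult[OF k \<psi>, of d "n div d"] by simp
        then show "\<psi> d * mangoldt d * \<psi> (n div d) = \<psi> n * mangoldt d" by simp
      qed
      then show ?thesis using mangoldt_sum[OF False, where ?'a = complex] by (simp flip: sum_distrib_left)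
    qed simp
  qed
  finally show ?thesis by (simp add: mult.commute)
qed

text \<open>The condition is a predicate because two kinds are needed: a residue class, and
  coprimality to \<open>k\<close> for the principal character.\<close>

definition class_mangoldt_sum :: "(nat \<Rightarrow> bool) \<Rightarrow> real \<Rightarrow> real" where
  "class_mangoldt_sum P s = (\<Sum>n. of_bool (P n) * mangoldt n * real n powr (- s))"

lemma class_mangoldt_summable:
  assumes "s > 1" shows "summable (\<lambda>n. of_bool (P n) * mangoldt n * real n powr (- s))"
proof (rule summable_comparison_test[OF _ summable_ln_powr[OF assms]])
  have "norm (of_bool (P n) * mangoldt n * real n powr (- s)) \<le> ln (real n) * real n powr (- s)" for n
  proof (cases "n = 0")
    case False
    then show ?thesis using mangoldt_le[of n] by (auto intro!: mult_right_mono simp: mangoldt_nonneg)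
  qed simp
  then show "\<exists>N. \<forall>n\<ge>N. norm (of_bool (P n) * mangoldt n * real n powr (- s)) \<le> ln (real n) * real n powr (- s)" by blast
qed

lemma class_mangoldt_sum_nonneg: "s > 1 \<Longrightarrow> class_mangoldt_sum P s \<ge> 0"
  unfolding class_mangoldt_sum_def
  by (intro suminf_nonneg class_mangoldt_summable) (auto simp: mangoldt_nonneg)

lemma dseries_of_bool_mangoldt:
  assumes "s > 1"
  shows "dseries (\<lambda>n. of_bool (P n) * mangoldt n) (of_real s) = of_real (class_mangoldt_sum P s)"
proof -
  have "(\<lambda>n. complex_of_real (of_bool (P n) * mangoldt n * real n powr (- s))) sums of_real (class_mangoldt_sum P s)"
    unfolding class_mangoldt_sum_def by (intro sums_of_real summable_sums class_mangoldt_summable assms)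
  moreover have "complex_of_real (of_bool (P n) * mangoldt n * real n powr (- s)) =
      of_bool (P n) * mangoldt n * of_nat n powr (- of_real s)" for n
    unfolding nat_powr_of_real by simp
  ultimately have "(\<lambda>n. of_bool (P n) * mangoldt n * of_nat n powr (- complex_of_real s)) sums of_real (class_mangoldt_sum P s)"
    by (simp only:)
  then show ?thesis unfolding dseries_def by (rule sums_unique[symmetric])
qed

lemma sum_chars_mangoldt:
  assumes k: "k > 1" and l: "coprime l k" and s: "s > 1"
  shows "(\<Sum>\<psi>\<in>dirichlet_chars k. cnj (\<psi> l) * dseries (\<lambda>n. \<psi> n * mangoldt n) (of_real s)) =
    of_real (real (card (dirichlet_chars k)) * class_mangoldt_sum (\<lambda>n. [n = l] (mod k)) s)"
proof -
  have k0: "k > 0" using k by simp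
  let ?X = "dirichlet_chars k" and ?p = "\<lambda>n. (of_nat n :: complex) powr (- of_real s)"
  have sm: "summable (\<lambda>n. \<psi> n * mangoldt n * ?p n)" if "\<psi> \<in> ?X" for \<psi>
    using s norm_char_le_1[OF k0 that]
    by (intro summable_dseries summable_norm_dseries_ln norm_mangoldt_mult_le) auto
  have "(\<Sum>\<psi>\<in>?X. cnj (\<psi> l) * dseries (\<lambda>n. \<psi> n * mangoldt n) (of_real s)) =
      (\<Sum>\<psi>\<in>?X. \<Sum>n. cnj (\<psi> l) * (\<psi> n * mangoldt n * ?p n))"
    unfolding dseries_def by (intro sum.cong refl suminf_mult[symmetric] sm)
  also have "\<dots> = (\<Sum>n. \<Sum>\<psi>\<in>?X. cnj (\<psi> l) * (\<psi> n * mangoldt n * ?p n))"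
    by (intro suminf_sum[symmetric] summable_mult sm)
  also have "\<dots> = (\<Sum>n. of_nat (card ?X) * (of_bool ([n = l] (mod k)) * mangoldt n * ?p n))"
  proof (rule suminf_cong)
    fix n
    have "(\<Sum>\<psi>\<in>?X. cnj (\<psi> l) * (\<psi> n * mangoldt n * ?p n)) = (\<Sum>\<psi>\<in>?X. cnj (\<psi> l) * \<psi> n) * (mangoldt n * ?p n)"
      by (simp add: sum_distrib_right mult.assoc)
    then show "(\<Sum>\<psi>\<in>?X. cnj (\<psi> l) * (\<psi> n * mangoldt n * ?p n)) =
        of_nat (card ?X) * (of_bool ([n = l] (mod k)) * mangoldt n * ?p n)"
      by (simp add: sum_chars_cnj_mult[OF k l])
  qed
  also have "\<dots> = of_nat (card ?X) * dseries (\<lambda>n. of_bool ([n = l] (mod k)) * mangoldt n) (of_real s)"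
    unfolding dseries_def
    using s by (intro suminf_mult summable_dseries summable_norm_dseries_ln norm_mangoldt_mult_le) auto
  finally show ?thesis by (simp add: dseries_of_bool_mangoldt[OF s])
qed

text \<open>The squared norm, unlike a logarithm, causes no trouble at zeros of \<open>f\<close>;
  since \<open>g\<close> is real, real and imaginary part satisfy the same equation.\<close>

lemma norm_square_derivative:
  assumes "(f has_field_derivative - of_real g * f (of_real s)) (at (complex_of_real s))"
  shows "((\<lambda>x. (norm (f (of_real x)))\<^sup>2) has_real_derivative - 2 * g * (norm (f (of_real s)))\<^sup>2) (at s)"
proof -
  have v: "((\<lambda>x. f (of_real x)) has_vector_derivative - of_real g * f (of_real s)) (at s)"
    by (rule has_vector_derivative_real_field[OF assms])
  have "((\<lambda>x. Re (f (of_real x))) has_real_derivative - g * Re (f (of_real s))) (at s)"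
    using bounded_linear.has_vector_derivative[OF bounded_linear_Re v] by (simp add: has_real_derivative_iff_has_vector_derivative)
  moreover have "((\<lambda>x. Im (f (of_real x))) has_real_derivative - g * Im (f (of_real s))) (at s)"
    using bounded_linear.has_vector_derivative[OF bounded_linear_Im v] by (simp add: has_real_derivative_iff_has_vector_derivative)
  ultimately have "((\<lambda>x. Re (f (of_real x)) * Re (f (of_real x)) + Im (f (of_real x)) * Im (f (of_real x))) has_real_derivative
     (- g * Re (f (of_real s))) * Re (f (of_real s)) + (- g * Re (f (of_real s))) * Re (f (of_real s)) +
     ((- g * Im (f (of_real s))) * Im (f (of_real s)) + (- g * Im (f (of_real s))) * Im (f (of_real s)))) (at s)"
    by (intro DERIV_add DERIV_mult)
  then show ?thesis
    unfolding cmod_power2 unfolding power2_eq_square by (rule DERIV_cong) (simp add: algebra_simps)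
qed

section \<open>Nonvanishing at 1 and its consequences\<close>

context
  fixes k :: nat assumes k: "k > 1"
begin

lemma modulus_pos: "k > 0" using k by simp

text \<open>For Re z > 1 this is the Dedekind zeta function of the \<open>k\<close>-th cyclotomic
  field, up to the Euler factors at the primes dividing \<open>k\<close>.\<close>

definition L_prod :: "complex \<Rightarrow> complex" where
  "L_prod z = (\<Prod>\<psi>\<in>dirichlet_chars k. dseries \<psi> z)"

lemma dseries_char_derivative:
  assumes \<psi>: "\<psi> \<in> dirichlet_chars k" and z: "Re z > 1"
  shows "(dseries \<psi> has_field_derivative - dseries (\<lambda>n. \<psi> n * mangoldt n) z * dseries \<psi> z) (at z)"
  using dseries_has_derivative[OF norm_char_le_1[OF modulus_pos \<psi>] z] dseries_mult_mangoldt[OF modulus_pos \<psi> z]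
  by (simp add: mult.commute)

text \<open>Orthogonality at \<open>l = 1\<close> turns the sum of the complex logarithmic
  derivatives into a real number of constant sign, which is what makes the norm monotone.\<close>

lemma L_prod_derivative:
  assumes s: "s > 1"
  shows "(L_prod has_field_derivative
    - of_real (real (card (dirichlet_chars k)) * class_mangoldt_sum (\<lambda>n. [n = 1] (mod k)) s) * L_prod (of_real s))
    (at (of_real s))"
proof -
  let ?X = "dirichlet_chars k" and ?z = "complex_of_real s"
  let ?F = "\<lambda>\<psi>. dseries (\<lambda>n. \<psi> n * mangoldt n) ?z"
  have fin: "finite ?X" by (rule finite_dirichlet_chars[OF modulus_pos])
  have "(L_prod has_field_derivative (\<Sum>\<psi>\<in>?X. - ?F \<psi> * dseries \<psi> ?z * (\<Prod>\<phi>\<in>?X - {\<psi>}. dseries \<phi> ?z))) (at ?z)"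
    unfolding L_prod_def[abs_def] using s by (intro has_field_derivative_prod dseries_char_derivative) auto
  also have "(\<Sum>\<psi>\<in>?X. - ?F \<psi> * dseries \<psi> ?z * (\<Prod>\<phi>\<in>?X - {\<psi>}. dseries \<phi> ?z)) = (\<Sum>\<psi>\<in>?X. - ?F \<psi> * L_prod ?z)"
    by (intro sum.cong refl) (simp add: L_prod_def prod.remove[OF fin] mult.assoc)
  also have "\<dots> = - (\<Sum>\<psi>\<in>?X. cnj (\<psi> 1) * ?F \<psi>) * L_prod ?z"
  proof -
    have "(\<Sum>\<psi>\<in>?X. cnj (\<psi> 1) * ?F \<psi>) = (\<Sum>\<psi>\<in>?X. ?F \<psi>)"
      by (intro sum.cong refl) (simp add: char_one[OF modulus_pos, simplified])
    then show ?thesis by (simp only: sum_negf[symmetric] sum_distrib_right)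
  qed
  also have "(\<Sum>\<psi>\<in>?X. cnj (\<psi> 1) * ?F \<psi>) =
      of_real (real (card (dirichlet_chars k)) * class_mangoldt_sum (\<lambda>n. [n = 1] (mod k)) s)"
    by (rule sum_chars_mangoldt[OF k _ s]) simp
  finally show ?thesis .
qed

lemma norm_L_prod_ge:
  assumes "1 < s" "s \<le> 3" shows "norm (L_prod (of_real s)) \<ge> norm (L_prod 3)"
proof -
  have "(norm (L_prod (of_real 3)))\<^sup>2 \<le> (norm (L_prod (of_real s)))\<^sup>2"
  proof (rule DERIV_nonpos_imp_nonincreasing[OF assms(2)])
    fix x assume "s \<le> x" "x \<le> 3"
    then have x: "x > 1" using assms by simp
    then show "\<exists>y. ((\<lambda>x. (norm (L_prod (of_real x)))\<^sup>2) has_real_derivative y) (at x) \<and> y \<le> 0"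
      using norm_square_derivative[OF L_prod_derivative[OF x]] class_mangoldt_sum_nonneg[OF x]
      by (intro exI conjI) (assumption | simp)+
  qed
  then show ?thesis by (simp add: power2_le_iff_abs_le)
qed

lemma L_prod_3_nonzero: "L_prod 3 \<noteq> 0"
proof -
  have "dseries \<psi> 3 \<noteq> 0" if "\<psi> \<in> dirichlet_chars k" for \<psi>
    by (rule dseries_3_nonzero) (use norm_char_le_1[OF modulus_pos that] char_one[OF modulus_pos that] in auto)
  then show ?thesis using finite_dirichlet_chars[OF modulus_pos] by (simp add: L_prod_def)
qed

lemma char_lipschitz:
  assumes "\<psi> \<in> dirichlet_chars k" "\<psi> \<noteq> principal_char k" "s \<ge> 1"
  shows "norm (dseries \<psi> (of_real s) - dseries \<psi> 1) \<le> (1 + 2 * real k) * (s - 1)"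
  using dseries_lipschitz[OF norm_char_le_1[OF modulus_pos assms(1)] norm_sum_char_le[OF modulus_pos assms(1,2)] assms(3), of 1] assms(3)
  by simp

text \<open>The principal factor of the product has at most a simple pole at \<open>1\<close>, so two vanishing factors
  would force the product to tend to \<open>0\<close>.\<close>

lemma at_most_one_zero:
  assumes \<psi>: "\<psi> \<in> dirichlet_chars k" "\<psi> \<noteq> principal_char k" "dseries \<psi> 1 = 0"
    and \<phi>: "\<phi> \<in> dirichlet_chars k" "\<phi> \<noteq> principal_char k" "dseries \<phi> 1 = 0"
  shows "\<psi> = \<phi>"
proof (rule ccontr)
  assume ne: "\<psi> \<noteq> \<phi>"
  let ?X = "dirichlet_chars k" and ?p = "principal_char k"
  have fin: "finite ?X" by (rule finite_dirichlet_chars[OF modulus_pos])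
  have pX: "?p \<in> ?X" by (rule principal_char_in_chars[OF modulus_pos])
  define C where "C = 1 + 2 * real k"
  define R where "R = ?X - {?p} - {\<psi>} - {\<phi>}"
  define K where "K = (\<Prod>\<theta>\<in>R. norm (dseries \<theta> 1) + C * 2)"
  have C: "C > 0" by (simp add: C_def add_pos_nonneg)
  have bound: "norm (L_prod 3) \<le> 3 * C * C * K * (s - 1)" if s: "1 < s" "s \<le> 3" for s
  proof -
    have zero: "norm (dseries \<theta> (of_real s)) \<le> C * (s - 1)"
      if "\<theta> \<in> ?X" "\<theta> \<noteq> ?p" "dseries \<theta> 1 = 0" for \<theta>
      using char_lipschitz[OF that(1,2), of s] that(3) s by (simp add: C_def)
    have p: "norm (dseries ?p (of_real s)) \<le> 3 / (s - 1)"
    proof -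
      have "norm (dseries ?p (of_real s)) \<le> s / (s - 1)"
        by (rule norm_dseries_le_zeta[OF norm_char_le_1[OF modulus_pos pX] s(1)])
      also have "\<dots> \<le> 3 / (s - 1)" using s by (intro divide_right_mono) auto
      finally show ?thesis .
    qed
    have rest: "(\<Prod>\<theta>\<in>R. norm (dseries \<theta> (of_real s))) \<le> K"
      unfolding K_def
    proof (intro prod_mono conjI norm_ge_zero)
      fix \<theta> assume "\<theta> \<in> R"
      then have "norm (dseries \<theta> (of_real s) - dseries \<theta> 1) \<le> C * (s - 1)"
        using char_lipschitz[of \<theta> s] s by (simp add: R_def C_def)
      also have "\<dots> \<le> C * 2" using s C by (intro mult_left_mono) auto
      finally show "norm (dseries \<theta> (of_real s)) \<le> norm (dseries \<theta> 1) + C * 2"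
        using norm_triangle_ineq2[of "dseries \<theta> (of_real s)" "dseries \<theta> 1"] by linarith
    qed
    have "norm (L_prod (of_real s)) = norm (dseries ?p (of_real s)) * (norm (dseries \<psi> (of_real s)) *
        (norm (dseries \<phi> (of_real s)) * (\<Prod>\<theta>\<in>R. norm (dseries \<theta> (of_real s)))))"
      unfolding L_prod_def prod_norm[symmetric] R_def
      using fin pX \<psi>(1,2) \<phi>(1,2) ne
      by (simp add: prod.remove[of ?X ?p] prod.remove[of "?X - {?p}" \<psi>] prod.remove[of "?X - {?p} - {\<psi>}" \<phi>])
    also have "\<dots> \<le> 3 / (s - 1) * (C * (s - 1) * (C * (s - 1) * K))"
      using p zero[OF \<psi>] zero[OF \<phi>] rest s C by (intro mult_mono) (auto intro!: mult_nonneg_nonneg prod_nonneg)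
    also have "\<dots> = 3 * C * C * K * (s - 1)" using s by (simp add: field_simps)
    finally show ?thesis using norm_L_prod_ge[OF s] by linarith
  qed
  define D where "D = 3 * C * C * K"
  have "D \<ge> 0" unfolding D_def K_def using C by (intro mult_nonneg_nonneg prod_nonneg) auto
  \<comment> \<open>\<open>e\<close> stands for \<open>s - 1\<close>: at most 2 so that
    \<open>s \<le> 3\<close>, and so small that the upper bound \<open>D * e\<close> is at most half
    of the positive lower bound. \<open>D + 1\<close> keeps the denominator positive.\<close>
  define e where "e = min 2 (norm (L_prod 3) / (2 * (D + 1)))"
  have np: "norm (L_prod 3) > 0" using L_prod_3_nonzero by simp
  then have e: "e > 0" "e \<le> 2" "e \<le> norm (L_prod 3) / (2 * (D + 1))" using \<open>D \<ge> 0\<close> by (auto simp: e_def)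
  have "norm (L_prod 3) \<le> D * e" using bound[of "1 + e"] e by (simp add: D_def)
  also have "\<dots> \<le> (D + 1) * e" using e by simp
  also have "\<dots> \<le> (D + 1) * (norm (L_prod 3) / (2 * (D + 1)))" using e \<open>D \<ge> 0\<close> by (intro mult_left_mono) auto
  also have "\<dots> = norm (L_prod 3) / 2" using \<open>D \<ge> 0\<close> by (simp add: field_simps)
  finally show False using np by simp
qed

lemma dseries_char_1_nonzero:
  assumes \<psi>: "\<psi> \<in> dirichlet_chars k" "\<psi> \<noteq> principal_char k"
  shows "dseries \<psi> 1 \<noteq> 0"
proof
  assume zero: "dseries \<psi> 1 = 0"
  let ?\<phi> = "\<lambda>n. cnj (\<psi> n)"
  have \<phi>: "?\<phi> \<in> dirichlet_chars k" by (rule char_cnj_closed[OF \<psi>(1)])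
  have \<phi>p: "?\<phi> \<noteq> principal_char k"
  proof
    assume "?\<phi> = principal_char k"
    then have "\<psi> n = principal_char k n" for n
      by (metis complex_cnj_cnj complex_cnj_one complex_cnj_zero of_bool_eq principal_char_def)
    then show False using \<psi>(2) by auto
  qed
  have "summable (\<lambda>n. \<psi> n * of_nat n powr (- complex_of_real 1))"
    by (rule summable_bounded_char[OF norm_sum_char_le[OF modulus_pos \<psi>]]) simp
  then have "(\<lambda>n. \<psi> n * of_nat n powr (- complex_of_real 1)) sums dseries \<psi> 1"
    by (simp add: dseries_def summable_sums)
  then have "(\<lambda>n. cnj (\<psi> n * of_nat n powr (- complex_of_real 1))) sums cnj (dseries \<psi> 1)"
    by (simp only: sums_cnj)
  then have "(\<lambda>n. ?\<phi> n * of_nat n powr (- complex_of_real 1)) sums 0"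
    unfolding nat_powr_of_real zero by simp
  then have "dseries ?\<phi> (of_real 1) = 0" unfolding dseries_def by (rule sums_unique[symmetric])
  then have "?\<phi> = \<psi>" using at_most_one_zero[OF \<phi> \<phi>p _ \<psi> zero] by simp
  then have "cnj (\<psi> n) = \<psi> n" for n by (rule fun_cong)
  then show False using real_char_dseries_1_nonzero[OF modulus_pos \<psi>] zero by blast
qed

text \<open>The product of this series with L is - L', which is bounded near 1, and L itself keeps
  at least half of its nonzero size at 1. By the Lipschitz constant \<open>C\<close> the latter
  holds up to distance \<open>a / (2 * C)\<close>.\<close>

lemma char_mangoldt_bounded:
  assumes \<psi>: "\<psi> \<in> dirichlet_chars k" "\<psi> \<noteq> principal_char k"
  shows "\<exists>C. \<forall>\<^sub>F s in at_right 1. norm (dseries (\<lambda>n. \<psi> n * mangoldt n) (of_real s)) \<le> C"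
proof -
  define C where "C = 1 + 2 * real k"
  define a where "a = norm (dseries \<psi> 1)"
  have a: "a > 0" using dseries_char_1_nonzero[OF \<psi>] by (simp add: a_def)
  have C: "C > 0" by (simp add: C_def add_pos_nonneg)
  have "norm (dseries (\<lambda>n. \<psi> n * mangoldt n) (of_real s)) \<le> C / (a / 2)" if s: "1 < s" "s < 1 + a / (2 * C)" for s
  proof -
    have "norm (dseries \<psi> (of_real s) - dseries \<psi> 1) \<le> C * (s - 1)"
      using char_lipschitz[OF \<psi>, of s] s by (simp add: C_def)
    also have "\<dots> \<le> C * (a / (2 * C))" using s C by (intro mult_left_mono) auto
    also have "\<dots> = a / 2" using C by simp
    finally have L: "norm (dseries \<psi> (of_real s)) \<ge> a / 2"
      using norm_triangle_ineq2[of "dseries \<psi> 1" "dseries \<psi> (of_real s)"] by (simp add: a_def norm_minus_commute)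
    have "norm (dseries \<psi> (of_real s)) * norm (dseries (\<lambda>n. \<psi> n * mangoldt n) (of_real s)) \<le> C"
      using norm_dseries_ln_le[OF norm_char_le_1[OF modulus_pos \<psi>(1)] norm_sum_char_le[OF modulus_pos \<psi>] s(1)] s(1)
      by (simp add: C_def dseries_mult_mangoldt[OF modulus_pos \<psi>(1)] flip: norm_mult)
    then have "a / 2 * norm (dseries (\<lambda>n. \<psi> n * mangoldt n) (of_real s)) \<le> C"
      using mult_right_mono[OF L norm_ge_zero] by (rule order_trans[rotated])
    then show ?thesis using a by (simp add: field_simps)
  qed
  then show ?thesis
    using a C by (intro exI eventually_at_rightI[of 1 "1 + a / (2 * C)"]) auto
qed

text \<open>A bound on the logarithmic derivative would keep the principal L-series bounded near 1,
  hence also its partial sums over \<open>n = j * k + 1\<close>; in the limit these dominate a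
  multiple of the harmonic series.\<close>

lemma principal_mangoldt_unbounded:
  "\<not> (\<exists>C. \<forall>\<^sub>F s in at_right 1. class_mangoldt_sum (\<lambda>n. coprime n k) s \<le> C)"
proof
  assume "\<exists>C. \<forall>\<^sub>F s in at_right 1. class_mangoldt_sum (\<lambda>n. coprime n k) s \<le> C"
  then obtain C where "\<forall>\<^sub>F s in at_right 1. class_mangoldt_sum (\<lambda>n. coprime n k) s \<le> C" by blast
  then obtain b where b: "b > 1" and C: "\<And>s. 1 < s \<Longrightarrow> s < b \<Longrightarrow> class_mangoldt_sum (\<lambda>n. coprime n k) s \<le> C"
    unfolding eventually_at_right_field by blast
  define M where "M = \<bar>C\<bar>"
  define c where "c = (1 + b) / 2"
  have c: "1 < c" "c < b" using b by (simp_all add: c_def)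
  let ?L = "dseries (principal_char k)"
  define q where "q s = (norm (?L (of_real s)))\<^sup>2 * exp (2 * M * s)" for s
  have pX: "principal_char k \<in> dirichlet_chars k" by (rule principal_char_in_chars[OF modulus_pos])
  have q: "q s \<le> q c" if s: "1 < s" "s \<le> c" for s
  proof (rule DERIV_nonneg_imp_nondecreasing[OF s(2)])
    fix x assume "s \<le> x" "x \<le> c"
    then have x: "1 < x" "x < b" using s c by simp_all
    define g where "g = class_mangoldt_sum (\<lambda>n. coprime n k) x"
    have "(?L has_field_derivative - of_real g * ?L (of_real x)) (at (of_real x))"
      using dseries_char_derivative[OF pX, of "of_real x"] x dseries_of_bool_mangoldt[OF x(1), of "\<lambda>n. coprime n k"]
      by (simp add: principal_char_def[abs_def] g_def)
    from norm_square_derivative[OF this]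
    have "(q has_real_derivative (- 2 * g * (norm (?L (of_real x)))\<^sup>2) * exp (2 * M * x) +
        (exp (2 * M * x) * (2 * M)) * (norm (?L (of_real x)))\<^sup>2) (at x)"
      unfolding q_def[abs_def] by (intro DERIV_mult) (auto intro!: derivative_eq_intros)
    moreover have "(- 2 * g * (norm (?L (of_real x)))\<^sup>2) * exp (2 * M * x) +
        (exp (2 * M * x) * (2 * M)) * (norm (?L (of_real x)))\<^sup>2 = 2 * (M - g) * ((norm (?L (of_real x)))\<^sup>2 * exp (2 * M * x))"
      by (simp add: algebra_simps)
    moreover have "g \<le> M" using C[OF x] by (simp add: g_def M_def)
    ultimately show "\<exists>y. (q has_real_derivative y) (at x) \<and> 0 \<le> y" by (intro exI conjI) (assumption | simp)+
  qed
  define K where "K = sqrt (q c)"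
  have L_le: "norm (?L (of_real s)) \<le> K" if s: "1 < s" "s \<le> c" for s
  proof -
    have "(norm (?L (of_real s)))\<^sup>2 * 1 \<le> q s"
      unfolding q_def using s by (intro mult_left_mono) (auto simp: M_def)
    then have "(norm (?L (of_real s)))\<^sup>2 \<le> q c" using q[OF s] by linarith
    then show ?thesis unfolding K_def by (rule real_le_rsqrt)
  qed
  have part: "(\<Sum>j<J. real (j * k + 1) powr (- s)) \<le> K" if s: "1 < s" "s \<le> c" for s J
  proof -
    let ?r = "\<lambda>n. of_bool (coprime n k) * real n powr (- s)"
    have sm: "summable ?r"
      using s by (intro summable_comparison_test[of ?r "\<lambda>n. real n powr (- s)"]) (auto simp: summable_real_powr_iff)
    then have "(\<lambda>n. complex_of_real (?r n)) sums of_real (suminf ?r)" by (intro sums_of_real summable_sums)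
    moreover have "complex_of_real (?r n) = principal_char k n * of_nat n powr (- of_real s)" for n
      unfolding nat_powr_of_real by (simp add: principal_char_def)
    ultimately have "?L (of_real s) = of_real (suminf ?r)" unfolding dseries_def by (simp only: sums_iff)
    moreover have "suminf ?r \<ge> 0" using sm by (intro suminf_nonneg) auto
    ultimately have "suminf ?r \<le> K" using L_le[OF s] by simp
    moreover have "(\<Sum>n\<in>(\<lambda>j. j * k + 1) ` {..<J}. ?r n) \<le> suminf ?r"
      using sm by (intro sum_le_suminf) auto
    moreover have "(\<Sum>n\<in>(\<lambda>j. j * k + 1) ` {..<J}. ?r n) = (\<Sum>j<J. real (j * k + 1) powr (- s))"
    proof -
      have "inj_on (\<lambda>j. j * k + 1) {..<J}" using modulus_pos by (auto simp: inj_on_def)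
      moreover have "coprime (j * k + 1) k" for j
        by (metis coprime_1_left coprime_mod_left_iff modulus_pos mod_mult_self3 not_gr_zero mod_mod_trivial)
      ultimately show ?thesis by (subst sum.reindex) (simp_all only: o_def of_bool_eq mult_1)
    qed
    ultimately show ?thesis by linarith
  qed
  have part1: "(\<Sum>j<J. 1 / real (j * k + 1)) \<le> K" for J
  proof (rule tendsto_upperbound)
    have "((\<lambda>s. \<Sum>j<J. real (j * k + 1) powr (- s)) \<longlongrightarrow> (\<Sum>j<J. real (j * k + 1) powr (- 1))) (at_right 1)"
      by (intro tendsto_intros) (simp add: add_nonneg_eq_0_iff)
    then show "((\<lambda>s. \<Sum>j<J. real (j * k + 1) powr (- s)) \<longlongrightarrow> (\<Sum>j<J. 1 / real (j * k + 1))) (at_right 1)"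
      by (simp add: powr_minus_divide)
    show "\<forall>\<^sub>F s in at_right 1. (\<Sum>j<J. real (j * k + 1) powr (- s)) \<le> K"
      using c part by (intro eventually_at_rightI[of 1 c]) auto
  qed simp
  have "summable (\<lambda>j. inverse (real j))"
  proof (rule summableI_nonneg_bounded)
    fix J
    have "inverse (real j) \<le> (real k + 1) * (1 / real (j * k + 1))" for j
    proof (cases "j = 0")
      case False
      then have "real (j * k + 1) \<le> (real k + 1) * real j" by (simp add: algebra_simps)
      moreover have "real (j * k + 1) > 0" by (simp only: of_nat_0_less_iff)
      ultimately have "1 \<le> (real k + 1) * real j / real (j * k + 1)" by (simp only: pos_le_divide_eq mult_1)
      then show ?thesis using False by (simp add: field_simps)
    qed simp
    then have "(\<Sum>j<J. inverse (real j)) \<le> (\<Sum>j<J. (real k + 1) * (1 / real (j * k + 1)))" by (rule sum_mono)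
    also have "\<dots> = (real k + 1) * (\<Sum>j<J. 1 / real (j * k + 1))" by (rule sum_distrib_left[symmetric])
    also have "\<dots> \<le> (real k + 1) * K" using part1 by (intro mult_left_mono) auto
    finally show "(\<Sum>j<J. inverse (real j)) \<le> (real k + 1) * K" .
  qed simp
  then show False using not_summable_harmonic[where ?'a = real] by simp
qed

text \<open>In the orthogonality relation the nonprincipal terms stay bounded near 1, while the
  principal one has coefficient 1 and does not.\<close>

lemma class_mangoldt_unbounded:
  assumes l: "coprime l k"
  shows "\<not> (\<exists>C. \<forall>\<^sub>F s in at_right 1. class_mangoldt_sum (\<lambda>n. [n = l] (mod k)) s \<le> C)"
proof
  assume "\<exists>C. \<forall>\<^sub>F s in at_right 1. class_mangoldt_sum (\<lambda>n. [n = l] (mod k)) s \<le> C"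
  then obtain C where C: "\<forall>\<^sub>F s in at_right 1. class_mangoldt_sum (\<lambda>n. [n = l] (mod k)) s \<le> C" by blast
  let ?X = "dirichlet_chars k" and ?p = "principal_char k"
  let ?F = "\<lambda>\<psi> s. dseries (\<lambda>n. \<psi> n * mangoldt n) (complex_of_real s)"
  have fin: "finite ?X" by (rule finite_dirichlet_chars[OF modulus_pos])
  have pX: "?p \<in> ?X" by (rule principal_char_in_chars[OF modulus_pos])
  have "\<forall>\<psi>\<in>?X - {?p}. \<exists>D. \<forall>\<^sub>F s in at_right 1. norm (?F \<psi> s) \<le> D"
    using char_mangoldt_bounded by blast
  then obtain D where D: "\<forall>\<psi>\<in>?X - {?p}. \<forall>\<^sub>F s in at_right 1. norm (?F \<psi> s) \<le> D \<psi>" by metis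
  then have "\<forall>\<^sub>F s in at_right 1. \<forall>\<psi>\<in>?X - {?p}. norm (?F \<psi> s) \<le> D \<psi>"
    using fin by (simp add: eventually_ball_finite)
  with C have "\<forall>\<^sub>F s in at_right 1. class_mangoldt_sum (\<lambda>n. coprime n k) s \<le> real (card ?X) * C + sum D (?X - {?p})"
    using eventually_at_right_less[of "1 :: real"]
  proof eventually_elim
    case (elim s)
    have "(\<Sum>\<psi>\<in>?X. cnj (\<psi> l) * ?F \<psi> s) = ?F ?p s + (\<Sum>\<psi>\<in>?X - {?p}. cnj (\<psi> l) * ?F \<psi> s)"
      using l by (subst sum.remove[OF fin pX]) (simp add: principal_char_def[of k l])
    moreover have "?F ?p s = of_real (class_mangoldt_sum (\<lambda>n. coprime n k) s)"
      using dseries_of_bool_mangoldt[OF elim(3), of "\<lambda>n. coprime n k"] by (simp add: principal_char_def[abs_def])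
    ultimately have "complex_of_real (class_mangoldt_sum (\<lambda>n. coprime n k) s) =
       of_real (real (card ?X) * class_mangoldt_sum (\<lambda>n. [n = l] (mod k)) s) - (\<Sum>\<psi>\<in>?X - {?p}. cnj (\<psi> l) * ?F \<psi> s)"
      using sum_chars_mangoldt[OF k l elim(3)] by (simp add: algebra_simps)
    then have "class_mangoldt_sum (\<lambda>n. coprime n k) s =
       real (card ?X) * class_mangoldt_sum (\<lambda>n. [n = l] (mod k)) s - Re (\<Sum>\<psi>\<in>?X - {?p}. cnj (\<psi> l) * ?F \<psi> s)"
      by (drule_tac arg_cong[where f = Re]) simp
    moreover have "- Re (\<Sum>\<psi>\<in>?X - {?p}. cnj (\<psi> l) * ?F \<psi> s) \<le> norm (\<Sum>\<psi>\<in>?X - {?p}. cnj (\<psi> l) * ?F \<psi> s)"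
      using abs_Re_le_cmod abs_le_D2 by blast
    moreover have "norm (\<Sum>\<psi>\<in>?X - {?p}. cnj (\<psi> l) * ?F \<psi> s) \<le> sum D (?X - {?p})"
      using elim(2) norm_char[OF modulus_pos _ l] by (intro sum_norm_le) (simp add: norm_mult)
    moreover have "real (card ?X) * class_mangoldt_sum (\<lambda>n. [n = l] (mod k)) s \<le> real (card ?X) * C"
      using elim(1) by (intro mult_left_mono) auto
    ultimately show ?case by linarith
  qed
  then show False using principal_mangoldt_unbounded by blast
qed

end

section \<open>From prime powers to primes\<close>

lemma summable_mangoldt_nonprime:
  "summable (\<lambda>n. if prime n then 0 else mangoldt n / real n)"
proof -
  \<comment> \<open>Off the primes only the powers \<open>p ^ (j + 2)\<close> count, with terms at
    most \<open>(ln p / p ^ 2) * (1 / 2) ^ j\<close>, a product of two summable families.\<close>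
  define h :: "nat \<times> nat \<Rightarrow> nat" where "h = (\<lambda>(p, j). p ^ (j + 2))"
  let ?A = "{p :: nat. prime p} \<times> (UNIV :: nat set)"
  let ?f = "\<lambda>n :: nat. (if prime n then 0 else mangoldt n / real n) :: real"
  have inj: "inj_on h ?A"
  proof (rule inj_onI)
    fix x y assume xy: "x \<in> ?A" "y \<in> ?A" "h x = h y"
    obtain p i q j where "x = (p, i)" "y = (q, j)" by (cases x, cases y) blast
    moreover from this xy have "p = q" "i + 2 = j + 2"
      using prime_power_inj'[of p q "i + 2" "j + 2"] by (simp_all add: h_def del: power_Suc add_2_eq_Suc')
    ultimately show "x = y" by simp
  qed
  have "summable (\<lambda>p. norm (ln (real p) * real p powr (- 2)))"
  proof -
    have "norm (ln (real p) * real p powr (- 2)) = ln (real p) * real p powr (- 2)" for p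
      by (cases "p = 0") auto
    then show ?thesis using summable_ln_powr[of 2] by simp
  qed
  then have s1: "(\<lambda>p. ln (real p) * real p powr (- 2)) summable_on UNIV"
    by (rule norm_summable_imp_summable_on)
  have s2: "(\<lambda>j. (1 / 2 :: real) ^ j) summable_on UNIV"
    by (rule norm_summable_imp_summable_on) (simp add: norm_power summable_geometric)
  have nn: "norm (ln (real p) * real p powr (- 2)) = ln (real p) * real p powr (- 2)" for p
    by (cases "p = 0") auto
  have "(\<lambda>(p, j). (ln (real p) * real p powr (- 2)) * (1 / 2) ^ j) summable_on (UNIV \<times> UNIV)"
    by (rule has_sum_imp_summable[OF has_sum_mult_pairs[OF _ _ has_sum_infsum[OF s1] has_sum_infsum[OF s2]]])
      (use s1 s2 in \<open>simp_all only: nn, simp_all add: norm_power\<close>)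
  then have "(\<lambda>(p, j). (ln (real p) * real p powr (- 2)) * (1 / 2) ^ j) summable_on ?A"
    by (rule summable_on_subset_banach) simp
  then have "(?f \<circ> h) summable_on ?A"
  proof (rule summable_on_comparison_test)
    fix x assume "x \<in> ?A"
    then obtain p j where x: "x = (p, j)" and p: "prime p" by auto
    have p2: "p \<ge> 2" using prime_ge_2_nat[OF p] .
    have "(?f \<circ> h) x = ln (real p) / real p ^ (j + 2)"
      using p mangoldt_primepow'[OF p, of "j + 2", where ?'a = real] by (simp add: x h_def prime_power_iff del: power_Suc)
    also have "\<dots> = (ln (real p) * real p powr (- 2)) * (1 / real p) ^ j"
      using p2 by (simp add: powr_minus_divide power_add power_divide power2_eq_square)
    also have "\<dots> \<le> (ln (real p) * real p powr (- 2)) * (1 / 2) ^ j"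
      using p2 by (intro mult_left_mono power_mono divide_left_mono) auto
    finally show "(?f \<circ> h) x \<le> (case x of (p, j) \<Rightarrow> (ln (real p) * real p powr (- 2)) * (1 / 2) ^ j)" by (simp add: x)
  next
    fix x show "0 \<le> (?f \<circ> h) x" by (simp add: mangoldt_nonneg)
  qed
  then have im: "?f summable_on (h ` ?A)" using summable_on_reindex[OF inj, of ?f] by simp
  have zero: "?f n = 0" if "n \<notin> h ` ?A" for n
  proof (cases "primepow n")
    case True
    then obtain p i where pi: "prime p" "i > 0" "n = p ^ i" by (auto simp: primepow_def)
    have "\<not> i \<ge> 2"
    proof
      assume "i \<ge> 2"
      then have "h (p, i - 2) = n" by (simp add: h_def pi(3) flip: power_add del: power_Suc add_2_eq_Suc')
      then show False using that pi(1) by (metis UNIV_I imageI mem_Collect_eq mem_Sigma_iff)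
    qed
    then have "i = 1" using pi(2) by simp
    then show ?thesis using pi by simp
  qed (simp add: mangoldt_def)
  have "?f summable_on UNIV \<longleftrightarrow> ?f summable_on (h ` ?A)"
    by (rule summable_on_cong_neutral) (use zero in blast)+
  then show ?thesis using im summable_on_imp_summable by blast
qed

theorem dirichlet_primes:
  fixes k l :: nat
  assumes k: "k > 1" and l: "coprime l k"
  shows "infinite {p. prime p \<and> [p = l] (mod k)}"
proof
  let ?P = "{p. prime p \<and> [p = l] (mod k)}"
  assume fin: "finite ?P"
  \<comment> \<open>A majorant free of \<open>s\<close>: the finitely many primes of the class enter
    with factor 1, other primes contribute nothing, and nonprimes enter with exponent 1.\<close>
  define w where "w n = (if n \<in> ?P then ln (real n) else 0) + (if prime n then 0 else mangoldt n / real n)" for n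
  have sw: "summable w"
    unfolding w_def[abs_def] by (intro summable_add summable_mangoldt_nonprime summable_If_finite_set fin)
  have "class_mangoldt_sum (\<lambda>n. [n = l] (mod k)) s \<le> suminf w" if s: "s > 1" for s
    unfolding class_mangoldt_sum_def
  proof (rule suminf_le[OF _ class_mangoldt_summable[OF s] sw])
    fix n
    show "of_bool ([n = l] (mod k)) * mangoldt n * real n powr (- s) \<le> w n"
    proof (cases "n = 0")
      case False
      have "real n powr (- s) \<le> real n powr (- 1)" using False s by (intro powr_mono) auto
      then have p1: "real n powr (- s) \<le> 1 / real n" using False by (simp add: powr_minus_divide)
      have p2: "real n powr (- s) \<le> 1" using p1 False by (smt (verit) divide_le_eq_1 of_nat_1 of_nat_le_iff less_one not_less)
      show ?thesis
      proof (cases "prime n")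
        case True
        have "ln (real n) * real n powr (- s) \<le> ln (real n) * 1" using p2 False by (intro mult_left_mono) auto
        then show ?thesis using True by (simp add: w_def)
      next
        case nprime: False
        have "mangoldt n * real n powr (- s) \<le> mangoldt n * (1 / real n)"
          using p1 mangoldt_nonneg by (intro mult_left_mono) auto
        then show ?thesis using nprime by (auto simp: w_def mangoldt_nonneg)
      qed
    qed (simp add: w_def)
  qed
  then have "\<forall>\<^sub>F s in at_right 1. class_mangoldt_sum (\<lambda>n. [n = l] (mod k)) s \<le> suminf w"
    by (intro eventually_at_rightI[of 1 2]) auto
  then show False using class_mangoldt_unbounded[OF k l] by blast
qed

section \<open>Necklace systems\<close>

lemma indexed_empty [simp]: "indexed {#} = {}"
  by (simp add: indexed_def)

lemma indexed_add_mset: "indexed (add_mset x S) = insert (x, count S x) (indexed S)"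
  by (auto simp: indexed_def split: if_splits)

lemma not_in_indexed: "(x, count S x) \<notin> indexed S"
  by (simp add: indexed_def)

lemma finite_indexed [simp]: "finite (indexed S)"
  by (induction S) (simp_all add: indexed_add_mset)

lemma card_even_eq_card_odd_iff:
  assumes "finite A"
  shows "card {T. T \<subseteq> A \<and> P T \<and> even (f T)} = card {T. T \<subseteq> A \<and> P T \<and> odd (f T)} \<longleftrightarrow>
    (\<Sum>T\<in>Pow A. of_bool (P T) * (if even (f T) then 1 else - 1) :: int) = 0"
proof -
  have "(\<Sum>T\<in>Pow A. of_bool (P T) * (if even (f T) then 1 else - 1) :: int)
      = (\<Sum>T\<in>Pow A. of_bool (P T \<and> even (f T)) - of_bool (P T \<and> odd (f T)))"
    by (rule sum.cong) auto
  also have "\<dots> = int (card (Pow A \<inter> {T. P T \<and> even (f T)})) - int (card (Pow A \<inter> {T. P T \<and> odd (f T)}))"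
    using assms by (simp add: sum_subtractf of_bool_def sum.If_cases)
  also have "Pow A \<inter> {T. P T \<and> even (f T)} = {T. T \<subseteq> A \<and> P T \<and> even (f T)}" by auto
  also have "Pow A \<inter> {T. P T \<and> odd (f T)} = {T. T \<subseteq> A \<and> P T \<and> odd (f T)}" by auto
  finally show ?thesis by auto
qed

text \<open>The weight is an arbitrary function of product and size, so that adjoining an element
  merely changes the weight and explicit multisets evaluate by rewriting.\<close>

definition weighted_sum :: "int multiset \<Rightarrow> (int \<Rightarrow> nat \<Rightarrow> int) \<Rightarrow> int" where
  "weighted_sum S g = (\<Sum>T\<in>Pow (indexed S). g (iprod T) (card T))"

lemma weighted_sum_empty: "weighted_sum {#} g = g 1 0"
  by (simp add: weighted_sum_def iprod_def)

lemma weighted_sum_add_mset: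
  "weighted_sum (add_mset x S) g = weighted_sum S (\<lambda>y n. g y n + g (x * y) (Suc n))"
proof -
  let ?y = "(x, count S x)"
  have fin: "finite T" and notin: "?y \<notin> T" if "T \<subseteq> indexed S" for T
    using that not_in_indexed[of x S] finite_subset[OF that] by auto
  have disj: "Pow (indexed S) \<inter> insert ?y ` Pow (indexed S) = {}"
    using not_in_indexed[of x S] by auto
  have inj: "inj_on (insert ?y) (Pow (indexed S))"
    using notin by (intro inj_onI) (metis PowD insert_ident)
  have "weighted_sum (add_mset x S) g =
     (\<Sum>T\<in>Pow (indexed S). g (iprod T) (card T)) +
     (\<Sum>T\<in>Pow (indexed S). g (iprod (insert ?y T)) (card (insert ?y T)))"
    by (simp add: weighted_sum_def indexed_add_mset Pow_insert sum.union_disjoint disj sum.reindex[OF inj])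
  also have "(\<Sum>T\<in>Pow (indexed S). g (iprod (insert ?y T)) (card (insert ?y T))) =
     (\<Sum>T\<in>Pow (indexed S). g (x * iprod T) (Suc (card T)))"
    by (rule sum.cong) (auto simp: fin notin iprod_def)
  finally show ?thesis by (simp add: sum.distrib weighted_sum_def)
qed

section \<open>Balance as identities between indicators\<close>

definition residue_ind :: "int \<Rightarrow> int \<Rightarrow> int \<Rightarrow> int" where
  "residue_ind m r x = of_bool ([x = r] (mod m))"

text \<open>A class modulo \<open>2 * m\<close> is treated as a class modulo \<open>m\<close> with a
  sign: shifting \<open>x\<close> by \<open>m\<close> negates this value. The signed condition then
  has the shape of the unsigned one.\<close>

definition signed_ind :: "int \<Rightarrow> int \<Rightarrow> int \<Rightarrow> int" where
  "signed_ind m r x = (if even (class_sgn m x) then residue_ind m r x else - residue_ind m r x)"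

lemma balanced_iff:
  "balanced m S \<longleftrightarrow>
     (\<forall>r\<in>{0..<m}. weighted_sum S (\<lambda>x n. if even n then residue_ind m r x else - residue_ind m r x) = 0)"
  unfolding balanced_def weighted_sum_def residue_ind_def
  by (subst card_even_eq_card_odd_iff) (simp_all add: if_distrib cong: if_cong)

lemma signed_balanced_iff:
  "signed_balanced m S \<longleftrightarrow>
     (\<forall>r\<in>{0..<m}. weighted_sum S (\<lambda>x n. if even n then signed_ind m r x else - signed_ind m r x) = 0)"
proof -
  have *: "(\<lambda>x n. if even n then signed_ind m r x else - signed_ind m r x) =
    (\<lambda>x n. of_bool ([x = r] (mod m)) * (if even (int n + class_sgn m x) then 1 else - 1))" for r
    by (intro ext) (simp add: signed_ind_def residue_ind_def)
  show ?thesis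
    unfolding signed_balanced_def weighted_sum_def * by (subst card_even_eq_card_odd_iff) simp_all
qed

lemma balanced_singleton:
  "balanced m {#a#} \<longleftrightarrow> (\<forall>r\<in>{0..<m}. residue_ind m r 1 = residue_ind m r a)"
  by (simp add: balanced_iff weighted_sum_add_mset weighted_sum_empty)

lemma balanced_pair:
  "balanced m {#a, b#} \<longleftrightarrow> (\<forall>r\<in>{0..<m}.
     residue_ind m r 1 + residue_ind m r (a * b) = residue_ind m r a + residue_ind m r b)"
  by (simp add: balanced_iff weighted_sum_add_mset weighted_sum_empty algebra_simps)

lemma balanced_triple:
  "balanced m {#a, b, c#} \<longleftrightarrow> (\<forall>r\<in>{0..<m}.
     residue_ind m r 1 + residue_ind m r (a * b) + residue_ind m r (a * c) + residue_ind m r (b * c) =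
     residue_ind m r a + residue_ind m r b + residue_ind m r c + residue_ind m r (a * b * c))"
  by (simp add: balanced_iff weighted_sum_add_mset weighted_sum_empty algebra_simps)

lemma signed_balanced_singleton:
  "signed_balanced m {#a#} \<longleftrightarrow> (\<forall>r\<in>{0..<m}. signed_ind m r 1 = signed_ind m r a)"
  by (simp add: signed_balanced_iff weighted_sum_add_mset weighted_sum_empty)

lemma signed_balanced_pair:
  "signed_balanced m {#a, b#} \<longleftrightarrow> (\<forall>r\<in>{0..<m}.
     signed_ind m r 1 + signed_ind m r (a * b) = signed_ind m r a + signed_ind m r b)"
  by (simp add: signed_balanced_iff weighted_sum_add_mset weighted_sum_empty algebra_simps)

lemma not_balanced_empty: "m \<ge> 2 \<Longrightarrow> \<not> balanced m {#}"
  by (auto simp: balanced_iff weighted_sum_empty residue_ind_def intro!: bexI[of _ 1])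

lemma not_signed_balanced_empty: "m \<ge> 2 \<Longrightarrow> \<not> signed_balanced m {#}"
  by (auto simp: signed_balanced_iff weighted_sum_empty residue_ind_def signed_ind_def intro!: bexI[of _ 1])

lemma admissible_subset: "admissible n S \<Longrightarrow> T \<subseteq># S \<Longrightarrow> admissible n T"
  unfolding admissible_def
  by (meson mset_subset_eqD mset_subset_eq_count order_trans set_mset_mono)

lemma class_sgn_0_or_1:
  assumes "m \<ge> 2" obtains "class_sgn m x = 0" "x mod (2 * m) = x mod m"
    | "class_sgn m x = 1" "x mod (2 * m) = x mod m + m"
proof -
  let ?y = "x mod (2 * m)"
  have y: "0 \<le> ?y" "?y < 2 * m" using assms by simp_all
  have xm: "x mod m = ?y mod m" by (simp add: mod_mod_cancel)
  show thesis
  proof (cases "?y < m")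
    case True
    then have "class_sgn m x = 0" "x mod m = ?y"
      using y xm by (simp_all add: class_sgn_def)
    then show thesis using that(1) by simp
  next
    case False
    have "?y div m = 1" by (rule div_pos_geq[THEN trans]) (use False y assms in \<open>simp_all\<close>)
    then have "class_sgn m x = 1" by (simp add: class_sgn_def)
    moreover have "?y mod m = ?y - m"
      using \<open>?y div m = 1\<close> by (metis minus_div_mult_eq_mod mult_1)
    ultimately show thesis using that(2) xm by simp
  qed
qed

lemma signed_ind_cong:
  assumes "[x = y] (mod (2 * m))" shows "signed_ind m r x = signed_ind m r y"
proof -
  have "[x = y] (mod m)" using assms cong_modulus_mult[of x y m 2] by (simp add: mult.commute)
  then show ?thesis
    using assms by (auto simp: signed_ind_def residue_ind_def class_sgn_def cong_def)
qed

lemma signed_ind_nonzero_iff: "signed_ind m r x \<noteq> 0 \<longleftrightarrow> [x = r] (mod m)"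
  by (simp add: signed_ind_def residue_ind_def)

text \<open>A nonzero value fixes the residue modulo \<open>m\<close> through \<open>r\<close> and
  the sign, hence together the class modulo \<open>2 * m\<close>.\<close>

lemma signed_ind_eq_imp:
  assumes "m \<ge> 2" "[x = r] (mod m)"
  shows "signed_ind m r x = signed_ind m r y \<Longrightarrow> [x = y] (mod (2 * m))"
    and "signed_ind m r x = - signed_ind m r y \<Longrightarrow> [x = y + m] (mod (2 * m))"
proof -
  assume eq: "signed_ind m r x = signed_ind m r y"
  then have "[y = r] (mod m)" using assms signed_ind_nonzero_iff[of m r x] signed_ind_nonzero_iff[of m r y] by auto
  then have "x mod m = y mod m" using assms(2) by (simp add: cong_def)
  then show "[x = y] (mod (2 * m))" using eq \<open>[y = r] (mod m)\<close> assms(2)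
    by (cases rule: class_sgn_0_or_1[OF assms(1), of x]; cases rule: class_sgn_0_or_1[OF assms(1), of y])
      (auto simp: signed_ind_def residue_ind_def cong_def)
next
  assume eq: "signed_ind m r x = - signed_ind m r y"
  then have "[y = r] (mod m)" using assms signed_ind_nonzero_iff[of m r x] signed_ind_nonzero_iff[of m r y] by auto
  then have "x mod m = y mod m" using assms(2) by (simp add: cong_def)
  have "(y + m) mod (2 * m) = (y mod (2 * m) + m) mod (2 * m)" by (simp add: mod_add_left_eq)
  moreover have "r mod m mod (2 * m) = r mod m"
    using assms(1) pos_mod_bound[of m r] pos_mod_sign[of m r] by (intro mod_pos_pos_trivial) linarith+
  moreover have "(r mod m + m) mod (2 * m) = r mod m + m"
    using assms(1) pos_mod_bound[of m r] pos_mod_sign[of m r] by (intro mod_pos_pos_trivial) linarith+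
  ultimately
  show "[x = y + m] (mod (2 * m))" using eq \<open>[y = r] (mod m)\<close> assms(2) \<open>x mod m = y mod m\<close> assms(1)
    by (cases rule: class_sgn_0_or_1[OF assms(1), of x]; cases rule: class_sgn_0_or_1[OF assms(1), of y])
      (auto simp: signed_ind_def residue_ind_def cong_def)
qed


text \<open>At the class of 1 the empty subset counts positively and a pair cannot count negatively,
  so only a singleton \<equiv> 1 could compensate. For three elements the full product could do so
  too.\<close>

lemma not_balanced_small:
  assumes "m \<ge> 2" "size S \<le> 2" "\<And>x. x \<in># S \<Longrightarrow> \<not> [x = 1] (mod m)"
  shows "\<not> balanced m S"
proof -
  have "S = {#} \<or> (\<exists>a. S = {#a#}) \<or> (\<exists>a b. S = {#a, b#})"
  proof (cases S)
    case (add a S')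
    show ?thesis
    proof (cases S')
      case (add b S'')
      then have "S'' = {#}" using assms(2) \<open>S = add_mset a S'\<close> by simp
      then show ?thesis using add \<open>S = add_mset a S'\<close> by blast
    qed (use add in simp)
  qed simp
  then consider "S = {#}" | a where "S = {#a#}" | a b where "S = {#a, b#}"
    by blast
  then show ?thesis
  proof cases
    case 1 then show ?thesis using not_balanced_empty[OF assms(1)] by simp
  next
    case (2 a)
    then show ?thesis using assms
      by (auto simp: balanced_singleton residue_ind_def intro!: bexI[of _ 1])
  next
    case (3 a b)
    then show ?thesis using assms
      by (auto simp: balanced_pair residue_ind_def intro!: bexI[of _ 1])
  qed
qed

lemma prime_in_coprime_class:
  assumes "n \<ge> 2" "coprime r n" shows "\<not> empty_class n r"
proof -
  define l where "l = nat (r mod n)"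
  have l: "int l = r mod n" using assms(1) by (simp add: l_def)
  have "coprime (int l) (int (nat n))" using assms by (simp add: l)
  then have "coprime l (nat n)" by (simp only: coprime_int_iff)
  then have "infinite {p. prime p \<and> [p = l] (mod nat n)}"
    using assms(1) by (intro dirichlet_primes) auto
  then obtain p where p: "prime p" "[p = l] (mod nat n)" by (metis (no_types, lifting) Collect_empty_eq finite.emptyI)
  then have "[int p = int l] (mod int (nat n))" by (simp only: cong_int_iff)
  then have "[int p = r] (mod n)" using assms(1) by (simp add: l cong_def)
  then have "int p \<in> class_primes n r" using p(1) by (simp add: class_primes_def)
  then show ?thesis by (auto simp: empty_class_def)
qed

section \<open>Necklace pairs and triples\<close>

lemma no_primitive_necklace_pair:
  assumes "m \<ge> 2" "size S = 2" shows "\<not> primitive_necklace_system m S"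
proof
  assume prim: "primitive_necklace_system m S"
  then have adm: "admissible m S" and bal: "balanced m S"
    by (simp_all add: primitive_necklace_system_def necklace_system_def)
  obtain x where x: "x \<in># S" "[x = 1] (mod m)"
    using not_balanced_small[of m S] assms bal by auto
  have "balanced m {#x#}" using x(2) by (auto simp: balanced_singleton residue_ind_def cong_def)
  moreover have "{#x#} \<subset># S" using x(1) assms(2)
    by (auto simp: subset_mset_def)
  ultimately show False
    using prim admissible_subset[OF adm, of "{#x#}"] x(1)
    by (auto simp: primitive_necklace_system_def necklace_system_def)
qed

lemma primitive_signed_pair_not_one:
  assumes "primitive_signed_necklace_system m {#a, b#}"
  shows "\<not> [a = 1] (mod (2 * m))" "\<not> [b = 1] (mod (2 * m))"
proof -
  have "\<not> [x = 1] (mod (2 * m))" if "{#x#} \<subset># {#a, b#}" for x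
  proof
    assume "[x = 1] (mod (2 * m))"
    then have "signed_balanced m {#x#}"
      by (simp add: signed_balanced_singleton signed_ind_cong)
    then show False
      using that assms admissible_subset[OF _ subset_mset.less_imp_le[OF that]]
      by (auto simp: primitive_signed_necklace_system_def signed_necklace_system_def)
  qed
  moreover have "{#a#} \<subset># {#a, b#}" "{#b#} \<subset># {#a, b#}"
    by (simp_all add: subset_mset_def)
  ultimately show "\<not> [a = 1] (mod (2 * m))" "\<not> [b = 1] (mod (2 * m))" by blast+
qed

lemma primitive_signed_pair:
  assumes "m \<ge> 2" "primitive_signed_necklace_system m {#a, b#}"
  shows "[a * b = 1 + m] (mod (2 * m))" "[a = b + m] (mod (2 * m))"
proof -
  have bal: "signed_ind m r 1 + signed_ind m r (a * b) = signed_ind m r a + signed_ind m r b"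
    if "r \<in> {0..<m}" for r
    using assms(2) that by (simp add: primitive_signed_necklace_system_def signed_necklace_system_def signed_balanced_pair)
  have one: "signed_ind m 1 1 = 1"
    using assms(1) by (simp add: signed_ind_def residue_ind_def class_sgn_def)
  have range: "signed_ind m r x \<in> {-1, 0, 1}" for r x
    by (simp add: signed_ind_def residue_ind_def)
  have "signed_ind m 1 a \<noteq> 1" "signed_ind m 1 b \<noteq> 1"
    using signed_ind_eq_imp(1)[of m 1 1] assms(1) one primitive_signed_pair_not_one[OF assms(2)]
    by (metis cong_refl cong_sym)+
  \<comment> \<open>All values lie in {-1, 0, 1}. Those of \<open>a\<close> and \<open>b\<close> are
    not 1, so their sum is at most 0, and the product must offset the 1 of the empty subset.\<close>
  then have "signed_ind m 1 (a * b) = - 1"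
    using bal[of 1] one assms(1) range[of 1 a] range[of 1 b] range[of 1 "a * b"] by auto
  then show ab: "[a * b = 1 + m] (mod (2 * m))"
    using one assms(1) signed_ind_nonzero_iff[of m 1 "a * b"]
    by (intro signed_ind_eq_imp(2)[of m "a * b" 1]) auto
  \<comment> \<open>The empty subset and the pair thus cancel at every residue, so \<open>a\<close>
    and \<open>b\<close> must cancel as well; \<open>r = a mod m\<close> is where this is
    visible.\<close>
  have "signed_ind m r (a * b) = - signed_ind m r 1" for r
  proof -
    have mod: "[a * b = 1] (mod m)"
      using cong_modulus_mult[of "a * b" "1 + m" m 2] ab by (simp add: mult.commute cong_def)
    show ?thesis
    proof (cases "[1 = r] (mod m)")
      case True
      then have "signed_ind m r (a * b) = signed_ind m 1 (a * b)" "signed_ind m r 1 = signed_ind m 1 1"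
        by (simp_all add: signed_ind_def residue_ind_def cong_def)
      then show ?thesis using one \<open>signed_ind m 1 (a * b) = - 1\<close> by simp
    next
      case False
      then show ?thesis using mod by (auto simp: signed_ind_def residue_ind_def cong_def)
    qed
  qed
  with bal[of "a mod m"] have "signed_ind m (a mod m) a = - signed_ind m (a mod m) b"
    using assms(1) by simp
  then show "[a = b + m] (mod (2 * m))"
    using assms(1) by (intro signed_ind_eq_imp(2)[of m a "a mod m"]) (auto simp: cong_def)
qed

lemma class_sgn_eq_1:
  assumes "m \<le> x" "x < 2 * m" shows "class_sgn m x = 1"
proof -
  have "x div m = 1 + (x - m) div m" using assms by (simp add: div_pos_geq)
  then show ?thesis using assms by (simp add: class_sgn_def)
qed

text \<open>The subset products are 1, \<open>m - 1\<close>, \<open>2 * m - 1\<close> and, modulo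
  \<open>2 * m\<close>, \<open>m + 1\<close>. The even-sized subsets have products 1 and
  \<open>m + 1\<close>, the odd-sized ones the other two; each of these two pairs agrees modulo
  \<open>m\<close> and differs in sign, so it cancels.\<close>

lemma signed_balanced_minus_one_pair:
  assumes "m \<ge> 2" shows "signed_balanced m {#m - 1, 2 * m - 1#}"
proof -
  have "(m - 1) * (2 * m - 1) = m + 1 + 2 * m * (m - 2)" by (simp add: algebra_simps)
  then have prod: "[(m - 1) * (2 * m - 1) = m + 1] (mod (2 * m))"
    by (simp add: cong_def)
  have "class_sgn m 1 = 0" "class_sgn m (m - 1) = 0" using assms by (simp_all add: class_sgn_def)
  moreover have "class_sgn m (m + 1) = 1" "class_sgn m (2 * m - 1) = 1"
    using assms by (auto intro: class_sgn_eq_1)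
  moreover have "residue_ind m r (2 * m - 1) = residue_ind m r (m - 1)" for r
  proof -
    have "2 * m - 1 = (m - 1) + m" by simp
    then show ?thesis unfolding residue_ind_def cong_def by (metis mod_add_self2)
  qed
  moreover have "residue_ind m r (m + 1) = residue_ind m r 1" for r
    by (simp add: residue_ind_def cong_def)
  ultimately show ?thesis
    by (simp add: signed_balanced_pair signed_ind_cong[OF prod]) (simp add: signed_ind_def)
qed

text \<open>Both elements are -1 modulo \<open>m\<close>, which differs from 1 for
  \<open>m \<ge> 3\<close>, so a singleton cannot offset the empty product.\<close>

lemma not_signed_balanced_sub_minus_one_pair:
  assumes "m \<ge> 3" "T \<subset># {#m - 1, 2 * m - 1#}" shows "\<not> signed_balanced m T"
proof -
  have "size T < 2" using mset_subset_size[OF assms(2)] by simp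
  then consider "T = {#}" | x where "T = {#x#}"
    by (metis less_2_cases size_1_singleton_mset size_eq_0_iff_empty One_nat_def)
  then show ?thesis
  proof cases
    case 1 then show ?thesis using not_signed_balanced_empty assms(1) by simp
  next
    case (2 x)
    then have "x = m - 1 \<or> x = 2 * m - 1"
      using assms(2) by (auto simp: subset_mset_def)
    then have "[x = - 1] (mod m)"
      by (auto simp: cong_iff_dvd_diff)
    moreover have "\<not> [- 1 = 1] (mod m)"
      using assms(1) zdvd_imp_le[of m 2] by (auto simp: cong_iff_dvd_diff)
    ultimately have "\<not> [x = 1] (mod m)" by (metis cong_sym cong_trans)
    then have "signed_ind m 1 x = 0" "signed_ind m 1 1 \<noteq> 0"
      using signed_ind_nonzero_iff[of m 1] by auto
    then show ?thesis using 2 assms(1) by (auto simp: signed_balanced_singleton intro!: bexI[of _ 1])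
  qed
qed

text \<open>For even \<open>m\<close> both classes are coprime to \<open>2 * m\<close>. For
  \<open>m = 3\<close> the class of 2 modulo 6 is not coprime to 6 but contains the prime 2.\<close>

lemma admissible_minus_one_pair:
  assumes "m = 3 \<or> even m \<and> m > 2" shows "admissible (2 * m) {#m - 1, 2 * m - 1#}"
proof -
  have "coprime (2 * m - 1) (2 * m)" by (rule coprime_diff_one_left)
  then have ne2: "\<not> empty_class (2 * m) (2 * m - 1)"
    using assms by (intro prime_in_coprime_class) auto
  have ne1: "\<not> empty_class (2 * m) (m - 1)"
  proof (cases "m = 3")
    case True
    have "(2::int) \<in> class_primes 6 2" by (simp add: class_primes_def)
    then show ?thesis using True by (auto simp: empty_class_def)
  next
    case False
    then have "even m" "m > 2" using assms by auto
    then have "coprime (m - 1) m" "coprime (m - 1) 2" by (simp_all add: coprime_diff_one_left)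
    then have "coprime (m - 1) (2 * m)" by simp
    then show ?thesis using \<open>m > 2\<close> by (intro prime_in_coprime_class) auto
  qed
  show ?thesis
    using ne1 ne2 assms by (auto simp: admissible_def)
qed

text \<open>Modulo \<open>m\<close> the residues 1, \<open>a\<close>, \<open>b\<close>,
  \<open>c\<close> form a Klein four-group, in which two of the three elements multiply to the
  third. Subsets of even size yield 1, \<open>c\<close>, \<open>b\<close>, \<open>a\<close>, and
  those of odd size \<open>a\<close>, \<open>b\<close>, \<open>c\<close>, 1.\<close>

lemma primitive_necklace_triple:
  assumes m: "m \<ge> 2" and range: "a \<in> {0..<m}" "b \<in> {0..<m}" "c \<in> {0..<m}"
    and sq: "[a\<^sup>2 = 1] (mod m)" "[b\<^sup>2 = 1] (mod m)" "[c\<^sup>2 = 1] (mod m)"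
    and abc: "[a * b * c = 1] (mod m)"
    and ne1: "\<not> [a = 1] (mod m)" "\<not> [b = 1] (mod m)" "\<not> [c = 1] (mod m)"
  shows "primitive_necklace_system m {#a, b, c#}"
proof -
  have cancel: "[x * y = z] (mod m)" if "[z\<^sup>2 = 1] (mod m)" "[x * y * z = 1] (mod m)" for x y z :: int
  proof -
    have "[x * y * z * z = 1 * z] (mod m)" using that(2) by (rule cong_mult) simp
    moreover have "[x * y * z\<^sup>2 = x * y * 1] (mod m)" by (rule cong_mult[OF cong_refl that(1)])
    ultimately show ?thesis by (simp add: cong_def power2_eq_square mult.assoc)
  qed
  have ab: "[a * b = c] (mod m)" using cancel[of c a b] sq abc by simp
  have ac: "[a * c = b] (mod m)" using cancel[of b a c] sq abc by (simp add: mult_ac)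
  have bc: "[b * c = a] (mod m)" using cancel[of a b c] sq abc by (simp add: mult_ac)
  \<comment> \<open>Equality would give \<open>c\<close> \<equiv> \<open>a * b\<close> =
    \<open>a ^ 2\<close> \<equiv> 1. Distinctness settles the multiplicity condition whichever
    classes are isolated.\<close>
  have "a \<noteq> b" using ab sq(1) ne1(3) by (auto simp: power2_eq_square cong_def)
  moreover have "a \<noteq> c" using ac sq(1) ne1(2) by (auto simp: power2_eq_square cong_def)
  moreover have "b \<noteq> c" using bc sq(2) ne1(1) by (auto simp: power2_eq_square cong_def)
  ultimately have count: "count {#a, b, c#} r \<le> 1" for r by auto
  have "coprime x m" if "[x\<^sup>2 = 1] (mod m)" for x
    using cong_imp_coprime[OF cong_sym[OF that]] by simp
  then have "\<not> empty_class m x" if "x \<in># {#a, b, c#}" for x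
    using that sq m prime_in_coprime_class by auto
  then have "admissible m {#a, b, c#}"
    using range count by (auto simp: admissible_def)
  moreover have "residue_ind m r (a * b) = residue_ind m r c" "residue_ind m r (a * c) = residue_ind m r b"
    "residue_ind m r (b * c) = residue_ind m r a" "residue_ind m r (a * b * c) = residue_ind m r 1" for r
    using ab ac bc abc by (simp_all add: residue_ind_def cong_def)
  then have "balanced m {#a, b, c#}"
    by (simp add: balanced_triple)
  moreover have "\<not> balanced m T" if T: "T \<subset># {#a, b, c#}" for T
  proof (rule not_balanced_small[OF m])
    show "size T \<le> 2" using mset_subset_size[OF T] by simp
    show "\<not> [x = 1] (mod m)" if "x \<in># T" for x
      using ne1 mset_subset_eqD[OF subset_mset.less_imp_le[OF T] that] by auto
  qed
  ultimately show ?thesis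
    by (simp add: primitive_necklace_system_def necklace_system_def)
qed

text \<open>The example in (2) is split because it fails for m = 2 and for odd m \<ge> 5. Stating
  balance and the failure of balance below it separately shows that for odd m \<ge> 5 only the empty
  class of \<open>m - 1\<close> stands in the way.\<close>

theorem theorem2p20:
  fixes m :: int
  assumes "m \<ge> 2"
  shows
    "\<not> (\<exists>S. primitive_necklace_system m S \<and> size S = 2)
     \<and>
     (\<forall>a b. primitive_signed_necklace_system m {#a, b#} \<longrightarrow>
        [a * b = 1 + m] (mod (2 * m)) \<and> [a = b + m] (mod (2 * m)) \<and>
        \<not> [a = 1] (mod (2 * m)) \<and> \<not> [b = 1] (mod (2 * m)))
     \<and>
     (m = 3 \<or> even m \<and> m \<noteq> 2 \<longrightarrow> primitive_signed_necklace_system m {#m - 1, 2 * m - 1#})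
     \<and>
     signed_balanced m {#m - 1, 2 * m - 1#}
     \<and>
     (m \<noteq> 2 \<longrightarrow> (\<forall>T. T \<subset># {#m - 1, 2 * m - 1#} \<longrightarrow> \<not> signed_balanced m T))
     \<and>
     (\<forall>a\<in>{0..<m}. \<forall>b\<in>{0..<m}. \<forall>c\<in>{0..<m}.
        [a\<^sup>2 = 1] (mod m) \<and> [b\<^sup>2 = 1] (mod m) \<and> [c\<^sup>2 = 1] (mod m) \<and>
        [a * b * c = 1] (mod m) \<and>
        \<not> [a = 1] (mod m) \<and> \<not> [b = 1] (mod m) \<and> \<not> [c = 1] (mod m) \<longrightarrow>
        primitive_necklace_system m {#a, b, c#})"
proof (intro conjI)
  show "\<not> (\<exists>S. primitive_necklace_system m S \<and> size S = 2)"
    using no_primitive_necklace_pair[OF assms] by blast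
  show "\<forall>a b. primitive_signed_necklace_system m {#a, b#} \<longrightarrow>
        [a * b = 1 + m] (mod (2 * m)) \<and> [a = b + m] (mod (2 * m)) \<and>
        \<not> [a = 1] (mod (2 * m)) \<and> \<not> [b = 1] (mod (2 * m))"
    using primitive_signed_pair[OF assms] primitive_signed_pair_not_one by blast
  show bal: "signed_balanced m {#m - 1, 2 * m - 1#}"
    by (rule signed_balanced_minus_one_pair[OF assms])
  show sub: "m \<noteq> 2 \<longrightarrow> (\<forall>T. T \<subset># {#m - 1, 2 * m - 1#} \<longrightarrow> \<not> signed_balanced m T)"
    using not_signed_balanced_sub_minus_one_pair[of m] assms by auto
  show "m = 3 \<or> even m \<and> m \<noteq> 2 \<longrightarrow> primitive_signed_necklace_system m {#m - 1, 2 * m - 1#}"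
    using bal sub admissible_minus_one_pair[of m] assms
    by (auto simp: primitive_signed_necklace_system_def signed_necklace_system_def)
  show "\<forall>a\<in>{0..<m}. \<forall>b\<in>{0..<m}. \<forall>c\<in>{0..<m}.
        [a\<^sup>2 = 1] (mod m) \<and> [b\<^sup>2 = 1] (mod m) \<and> [c\<^sup>2 = 1] (mod m) \<and>
        [a * b * c = 1] (mod m) \<and>
        \<not> [a = 1] (mod m) \<and> \<not> [b = 1] (mod m) \<and> \<not> [c = 1] (mod m) \<longrightarrow>
        primitive_necklace_system m {#a, b, c#}"
    using primitive_necklace_triple[OF assms] by blast
qed

end
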